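(* If the costs of the projects are encoded in unary, then both the weighted problem GreedyAV-CC\$DC (weighted constructive control by deleting candidates) and the weighted problem GreedyAV-DC\$DC (weighted destructive control by deleting candidates) can be solved in polynomial time, even if the projects' weights are encoded in binary.
   Context: A participatory budgeting (PB) instance is a triple $E=(P,V,B)$, where $P$ is a finite set of projects, $V$ is a finite set of voters and $B\in\mathbb{N}$ is the budget. Each voter $v\in V$ has an approval set $A(v)\subseteq P$, and each project $p\in P$ has a cost $\mathrm{cost}(p)\in\mathbb{N}_{\ge 1}$ with $\mathrm{cost}(p)\le B$. For $S\subseteq P$, $\mathrm{cost}(S)=\sum_{p\in S}\mathrm{cost}(p)$. A PB rule $f$ maps a PB instance $E$ to a set $f(E)\subseteq P$ with $\mathrm{cost}(f(E))\le B$; projects in $f(E)$ are called funded. Rules are resolute: ties are resolved by a given tie-breaking order (a linear order over the projects), which is given together with the instance and is restricted to the remaining projects when projects are deleted. GreedyAV: let $\mathrm{score}_{AV}(p)=|\{v\in V: p\in A(v)\}|$. Start with $W=\emptyset$ and process the projects in non-increasing order of $\mathrm{score}_{AV}$ (ties by the tie-breaking order). When project $p$ is processed, add it to $W$ if $\mathrm{cost}(W)+\mathrm{cost}(p)\le B$; otherwise skip it. Stop when all projects have been processed and output $W$. $f$-CC\$DC: given a PB instance $E=(P,V,B)$, a nonnegative integer weight $\omega(q)$ for every project $q$, a nonnegative integer $r$ and a project $p\in P$ with $p\notin f(E)$, decide whether there is a set $D\subseteq P\setminus\{p\}$ with $\sum_{q\in D}\omega(q)\le r$ such that $p\in f((P\setminus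 D,V,B))$ (approval sets are restricted to the remaining projects). $f$-DC\$DC: the same input except that $p\in f(E)$; decide whether there is a set $D\subseteq P\setminus\{p\}$ with $\sum_{q\in D}\omega(q)\le r$ such that $p\notin f((P\setminus D,V,B))$. *)

theory Defs
  imports "HOL-Library.Log_Nat" "HOL-Computational_Algebra.Polynomial"
begin

section \<open>Participatory budgeting\<close>

text \<open>The list \<open>projects\<close> carries both the finite set of projects (its elements) and the
  tie-breaking order (earlier elements are preferred). The functions \<open>approves\<close> and \<open>cost\<close> are
  only meaningful on \<open>voters\<close> and on the elements of \<open>projects\<close>.\<close>

record ('p, 'v) pb =
  projects :: "'p list"
  voters :: "'v set"
  approves :: "'v \<Rightarrow> 'p set"
  cost :: "'p \<Rightarrow> nat"
  budget :: nat

definition pb_instance :: "('p, 'v) pb \<Rightarrow> bool" where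
  "pb_instance E \<longleftrightarrow>
     distinct (projects E) \<and> finite (voters E) \<and>
     (\<forall>v \<in> voters E. approves E v \<subseteq> set (projects E)) \<and>
     (\<forall>p \<in> set (projects E). 1 \<le> cost E p \<and> cost E p \<le> budget E)"

definition total_cost :: "('p, 'v) pb \<Rightarrow> 'p set \<Rightarrow> nat" where
  "total_cost E S = (\<Sum>p\<in>S. cost E p)"

definition delete_projects :: "'p set \<Rightarrow> ('p, 'v) pb \<Rightarrow> ('p, 'v) pb" where
  "delete_projects D E =
     E\<lparr>projects := filter (\<lambda>q. q \<notin> D) (projects E), approves := (\<lambda>v. approves E v - D)\<rparr>"

lemma pb_instance_delete_projects:
  "pb_instance E \<Longrightarrow> pb_instance (delete_projects D E)"
  by (auto simp: pb_instance_def delete_projects_def)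

subsection \<open>GreedyAV\<close>

definition score_AV :: "('p, 'v) pb \<Rightarrow> 'p \<Rightarrow> nat" where
  "score_AV E p = card {v \<in> voters E. p \<in> approves E v}"

text \<open>Sorting is stable, so projects of equal score stay in tie-breaking order.\<close>

definition processing_order :: "('p, 'v) pb \<Rightarrow> 'p list" where
  "processing_order E = sort_key (\<lambda>p. - int (score_AV E p)) (projects E)"

definition greedy_step :: "('p, 'v) pb \<Rightarrow> 'p \<Rightarrow> 'p set \<Rightarrow> 'p set" where
  "greedy_step E p W = (if total_cost E W + cost E p \<le> budget E then insert p W else W)"

definition greedyAV :: "('p, 'v) pb \<Rightarrow> 'p set" where
  "greedyAV E = fold (greedy_step E) (processing_order E) {}"

lemma greedyAV_subset: "greedyAV E \<subseteq> set (projects E)"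
proof -
  have "fold (greedy_step E) ps W \<subseteq> W \<union> set ps" for ps W
    by (induction ps arbitrary: W) (fastforce simp: greedy_step_def split: if_splits)+
  then show ?thesis
    by (force simp: greedyAV_def processing_order_def)
qed

lemma total_cost_greedyAV: "total_cost E (greedyAV E) \<le> budget E"
proof -
  have step: "total_cost E (greedy_step E p W) \<le> budget E" if "total_cost E W \<le> budget E" for p W
    using that by (cases "finite W"; cases "p \<in> W")
      (auto simp: greedy_step_def total_cost_def insert_absorb)
  have "total_cost E (fold (greedy_step E) ps W) \<le> budget E"
    if "total_cost E W \<le> budget E" for ps W
    using that by (induction ps arbitrary: W) (auto intro: step)
  then show ?thesis
    by (simp add: greedyAV_def total_cost_def)
qed

subsection \<open>Weighted control by deleting projects\<close>

record ('p, 'v) control_input =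
  election :: "('p, 'v) pb"
  weight :: "'p \<Rightarrow> nat"
  bound :: nat
  target :: 'p

definition deletion_sets :: "('p, 'v) control_input \<Rightarrow> 'p set set" where
  "deletion_sets I =
     {D. D \<subseteq> set (projects (election I)) - {target I} \<and> (\<Sum>q\<in>D. weight I q) \<le> bound I}"

definition ccdc_inputs :: "(('p, 'v) pb \<Rightarrow> 'p set) \<Rightarrow> ('p, 'v) control_input set" where
  "ccdc_inputs f =
     {I. pb_instance (election I) \<and> target I \<in> set (projects (election I)) \<and>
         target I \<notin> f (election I)}"

definition ccdc :: "(('p, 'v) pb \<Rightarrow> 'p set) \<Rightarrow> ('p, 'v) control_input \<Rightarrow> bool" where
  "ccdc f I \<longleftrightarrow> (\<exists>D \<in> deletion_sets I. target I \<in> f (delete_projects D (election I)))"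

definition dcdc_inputs :: "(('p, 'v) pb \<Rightarrow> 'p set) \<Rightarrow> ('p, 'v) control_input set" where
  "dcdc_inputs f =
     {I. pb_instance (election I) \<and> target I \<in> set (projects (election I)) \<and>
         target I \<in> f (election I)}"

definition dcdc :: "(('p, 'v) pb \<Rightarrow> 'p set) \<Rightarrow> ('p, 'v) control_input \<Rightarrow> bool" where
  "dcdc f I \<longleftrightarrow> (\<exists>D \<in> deletion_sets I. target I \<notin> f (delete_projects D (election I)))"

section \<open>Encoding of inputs as words\<close>

datatype symbol = Zero | One | Sep

definition bit_symbol :: "bool \<Rightarrow> symbol" where
  "bit_symbol b = (if b then One else Zero)"

fun binary_digits :: "nat \<Rightarrow> symbol list" where
  "binary_digits n =
     (if n = 0 then [] else binary_digits (n div 2) @ [bit_symbol (odd n)])"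

declare binary_digits.simps [simp del]

definition encode_binary :: "nat \<Rightarrow> symbol list" where
  "encode_binary n = binary_digits n @ [Sep]"

definition encode_unary :: "nat \<Rightarrow> symbol list" where
  "encode_unary n = replicate n One @ [Sep]"

text \<open>A project entry consists of a flag for the distinguished project, the cost in unary and the
  weight in binary.\<close>

definition encode_project :: "('p, 'v) control_input \<Rightarrow> 'p \<Rightarrow> symbol list" where
  "encode_project I q =
     bit_symbol (q = target I) # encode_unary (cost (election I) q) @ encode_binary (weight I q)"

text \<open>A voter entry is the row of the approval matrix, with columns in tie-breaking order.\<close>

definition encode_voter :: "('p, 'v) control_input \<Rightarrow> 'v \<Rightarrow> symbol list" where
  "encode_voter I v =
     map (\<lambda>q. bit_symbol (q \<in> approves (election I) v)) (projects (election I)) @ [Sep]"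

text \<open>Only the costs are in unary; the budget, the weights and the bound are in binary. As the
  voters form a set, an input has one encoding for each enumeration \<open>vs\<close> of the voters.\<close>

definition encodings :: "('p, 'v) control_input \<Rightarrow> symbol list set" where
  "encodings I =
     {encode_binary (budget (election I)) @ encode_binary (bound I) @
      concat (map (encode_project I) (projects (election I))) @ [Sep] @
      concat (map (encode_voter I) vs)
      | vs. distinct vs \<and> set vs = voters (election I)}"

section \<open>Polynomial time on random access machines with logarithmic cost\<close>

text \<open>Random access machine programs in structured form. Memory consists of arrays of natural
  numbers, numbered by natural numbers; a program refers to finitely many of them, and cells
  are addressed indirectly. The only arithmetic is addition and truncated subtraction.\<close>

type_synonym store = "nat \<Rightarrow> nat \<Rightarrow> nat"

datatype expr =
    Const nat
  | Cell nat expr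
  | Plus expr expr
  | Minus expr expr

datatype prog =
    Skip
  | Assign nat expr expr
  | Seq prog prog
  | Cond expr prog prog
  | While expr prog

fun eval_expr :: "expr \<Rightarrow> store \<Rightarrow> nat" where
  "eval_expr (Const n) s = n"
| "eval_expr (Cell a e) s = s a (eval_expr e s)"
| "eval_expr (Plus e e') s = eval_expr e s + eval_expr e' s"
| "eval_expr (Minus e e') s = eval_expr e s - eval_expr e' s"

definition log_size :: "nat \<Rightarrow> nat" where
  "log_size n = max 1 (floorlog 2 n)"

text \<open>Logarithmic cost: every address, operand and result is charged its binary length.\<close>

fun expr_time :: "expr \<Rightarrow> store \<Rightarrow> nat" where
  "expr_time (Const n) s = log_size n"
| "expr_time (Cell a e) s = expr_time e s + log_size (eval_expr (Cell a e) s)"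
| "expr_time (Plus e e') s = expr_time e s + expr_time e' s + log_size (eval_expr (Plus e e') s)"
| "expr_time (Minus e e') s = expr_time e s + expr_time e' s + log_size (eval_expr (Minus e e') s)"

text \<open>\<open>exec c s t s'\<close>: started in \<open>s\<close>, program \<open>c\<close> halts in \<open>s'\<close> after time \<open>t\<close>. A condition
  holds iff its value is nonzero.\<close>

inductive exec :: "prog \<Rightarrow> store \<Rightarrow> nat \<Rightarrow> store \<Rightarrow> bool" where
  Skip: "exec Skip s 1 s"
| Assign: "exec (Assign a i e) s (1 + expr_time i s + expr_time e s)
     (s(a := (s a)(eval_expr i s := eval_expr e s)))"
| Seq: "exec c s t s' \<Longrightarrow> exec c' s' t' s'' \<Longrightarrow> exec (Seq c c') s (t + t') s''"
| CondTrue: "eval_expr b s \<noteq> 0 \<Longrightarrow> exec c s t s' \<Longrightarrow>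
     exec (Cond b c c') s (1 + expr_time b s + t) s'"
| CondFalse: "eval_expr b s = 0 \<Longrightarrow> exec c' s t s' \<Longrightarrow>
     exec (Cond b c c') s (1 + expr_time b s + t) s'"
| WhileFalse: "eval_expr b s = 0 \<Longrightarrow> exec (While b c) s (1 + expr_time b s) s"
| WhileTrue: "eval_expr b s \<noteq> 0 \<Longrightarrow> exec c s t s' \<Longrightarrow> exec (While b c) s' t' s'' \<Longrightarrow>
     exec (While b c) s (1 + expr_time b s + t + t') s''"

lemma exec_deterministic:
  "exec c s t s' \<Longrightarrow> exec c s u s'' \<Longrightarrow> u = t \<and> s'' = s'"
proof (induction arbitrary: u s'' rule: exec.induct)
  case Skip
  then show ?case by cases simp
next
  case Assign
  then show ?case by cases simp
next
  case Seq
  from Seq.prems show ?case by cases (use Seq.IH in blast)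
next
  case CondTrue
  from CondTrue.prems show ?case by cases (use CondTrue.hyps CondTrue.IH in blast)+
next
  case CondFalse
  from CondFalse.prems show ?case by cases (use CondFalse.hyps CondFalse.IH in blast)+
next
  case WhileFalse
  from WhileFalse.prems show ?case by cases (use WhileFalse.hyps in simp_all)
next
  case WhileTrue
  from WhileTrue.prems show ?case by cases (use WhileTrue.hyps WhileTrue.IH in blast)+
qed

fun symbol_code :: "symbol \<Rightarrow> nat" where
  "symbol_code Zero = 1"
| "symbol_code One = 2"
| "symbol_code Sep = 3"

text \<open>The input word is in array \<open>0\<close>, one symbol per cell; all other cells contain \<open>0\<close>, which is
  not the code of a symbol. The answer is read from cell \<open>0\<close> of array \<open>1\<close>.\<close>

definition initial_store :: "symbol list \<Rightarrow> store" where
  "initial_store w = (\<lambda>a i. if a = 0 \<and> i < length w then symbol_code (w ! i) else 0)"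

definition polytime_decidable ::
    "('i \<Rightarrow> symbol list set) \<Rightarrow> 'i set \<Rightarrow> ('i \<Rightarrow> bool) \<Rightarrow> bool" where
  "polytime_decidable enc inputs yes \<longleftrightarrow>
     (\<exists>(c :: prog) (q :: nat poly). \<forall>x \<in> inputs. \<forall>w \<in> enc x.
        \<exists>t s. exec c (initial_store w) t s \<and> t \<le> poly q (length w) \<and>
              s 1 0 = (if yes x then 1 else 0))"

end

theory Submission
  imports Defs
begin

text \<open>Deleting projects does not change the scores, so only the projects processed before the
  target \<open>p\<close> matter, and \<open>p\<close> is funded iff the greedy run on the remaining ones among them leaves
  room for \<open>p\<close>. The state of that run is the cost \<open>c\<close> of the projects funded so far. For every
  \<open>c\<close> a dynamic program keeps the cheapest weight of a deletion leading to \<open>c\<close>; as the costs are in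
  unary, \<open>c\<close> is at most the length of the input. The answer is found by looking for an affordable
  \<open>c\<close> that leaves (for destructive control: does not leave) room for \<open>p\<close>. The processing order is
  obtained by bucket sort on the number of voters who do not approve a project.

  The running time of the random access machine program is counted in unit steps. Since a program
  can only add and subtract, one step increases the binary length of the stored numbers by at most
  a constant, so a polynomial number of steps implies polynomial logarithmic cost.\<close>

section \<open>Unit cost versus logarithmic cost\<close>

text \<open>A constant counts with its value. The size then bounds the number of bits by which a
  result can exceed the stored numbers.\<close>

fun expr_size :: "expr \<Rightarrow> nat" where
  "expr_size (Const n) = n + 1"
| "expr_size (Cell a e) = expr_size e + 1"
| "expr_size (Plus e e') = expr_size e + expr_size e' + 1"
| "expr_size (Minus e e') = expr_size e + expr_size e' + 1"

fun prog_size :: "prog \<Rightarrow> nat" where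
  "prog_size Skip = 0"
| "prog_size (Assign a i e) = expr_size i + expr_size e"
| "prog_size (Seq c c') = prog_size c + prog_size c'"
| "prog_size (Cond b c c') = expr_size b + prog_size c + prog_size c'"
| "prog_size (While b c) = expr_size b + prog_size c"

definition bounded_store :: "nat \<Rightarrow> store \<Rightarrow> bool" where
  "bounded_store L s \<longleftrightarrow> (\<forall>a i. s a i \<le> 2 ^ L)"

lemma bounded_store_mono: "bounded_store L s \<Longrightarrow> L \<le> L' \<Longrightarrow> bounded_store L' s"
  unfolding bounded_store_def by (meson le_trans one_le_numeral power_increasing)

text \<open>Adding two numbers that are at most a power of two raises the exponent by at most one,
  and every node of the expression contributes at least one to \<open>expr_size\<close>.\<close>

lemma eval_expr_le: "bounded_store L s \<Longrightarrow> eval_expr e s \<le> 2 ^ (L + expr_size e)"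
proof (induction e)
  case (Const n)
  have "n \<le> 2 ^ n" by (simp add: less_imp_le)
  also have "\<dots> \<le> 2 ^ (L + expr_size (Const n))" by (rule power_increasing) simp_all
  finally show ?case by simp
next
  case (Cell a e)
  have "s a (eval_expr e s) \<le> 2 ^ L" using Cell.prems by (simp add: bounded_store_def)
  also have "\<dots> \<le> 2 ^ (L + expr_size (Cell a e))" by (rule power_increasing) simp_all
  finally show ?case by simp
next
  case (Plus e e')
  let ?k = "L + expr_size e + expr_size e'"
  have "2 ^ (L + expr_size e) \<le> (2::nat) ^ ?k" "2 ^ (L + expr_size e') \<le> (2::nat) ^ ?k"
    by (rule power_increasing; simp)+
  then have "eval_expr e s \<le> 2 ^ ?k" "eval_expr e' s \<le> 2 ^ ?k"
    using Plus.IH[OF Plus.prems] by linarith+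
  then show ?case by (simp add: add.assoc)
next
  case (Minus e e')
  have "eval_expr e s \<le> 2 ^ (L + expr_size e)" using Minus by simp
  also have "\<dots> \<le> 2 ^ (L + expr_size (Minus e e'))" by (rule power_increasing) simp_all
  finally show ?case by simp
qed

lemma log_size_le: "n \<le> 2 ^ k \<Longrightarrow> log_size n \<le> k + 1"
proof -
  assume "n \<le> 2 ^ k"
  moreover have "(2::nat) ^ k < 2 ^ (k + 1)" by simp
  ultimately have "n < 2 ^ (k + 1)" by linarith
  then have "floorlog 2 n \<le> k + 1"
    by (simp add: floorlog_le_iff)
  then show ?thesis by (simp add: log_size_def)
qed

text \<open>Each node is charged at most \<open>L + m + 1\<close>, and \<open>expr_size\<close>
  bounds the number of nodes. The separate bound \<open>m\<close> stays fixed when the induction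
  passes to subexpressions.\<close>

lemma expr_time_le:
  "bounded_store L s \<Longrightarrow> expr_size e \<le> m \<Longrightarrow> expr_time e s \<le> expr_size e * (L + m + 1)"
proof (induction e)
  case (Const n)
  have "log_size n \<le> n + 1" by (rule log_size_le) (simp add: less_imp_le)
  then show ?case using Const by (simp add: trans_le_add1)
next
  case (Cell a e)
  have "log_size (eval_expr (Cell a e) s) \<le> L + m + 1"
    using log_size_le[OF eval_expr_le[OF Cell.prems(1), of "Cell a e"]] Cell.prems(2) by simp
  then show ?case using Cell by simp
next
  case (Plus e e')
  have "log_size (eval_expr (Plus e e') s) \<le> L + m + 1"
    using log_size_le[OF eval_expr_le[OF Plus.prems(1), of "Plus e e'"]] Plus.prems(2) by simp
  then show ?case using Plus by (simp add: algebra_simps)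
next
  case (Minus e e')
  have "log_size (eval_expr (Minus e e') s) \<le> L + m + 1"
    using log_size_le[OF eval_expr_le[OF Minus.prems(1), of "Minus e e'"]] Minus.prems(2) by simp
  then show ?case using Minus by (simp add: algebra_simps)
qed

text \<open>The allowance for \<open>k\<close> steps of a program of size at most \<open>m\<close>:
  each step is charged as if the numbers already had their final length
  \<open>L + m * k\<close>.\<close>

definition log_time :: "nat \<Rightarrow> nat \<Rightarrow> nat \<Rightarrow> nat" where
  "log_time m L k = k * (1 + m * (L + m * k + m + 1))"

text \<open>Both parts can be charged at the common final length
  \<open>L + m * (k + k')\<close>.\<close>

lemma log_time_add: "log_time m L k + log_time m (L + m * k) k' \<le> log_time m L (k + k')"
proof -
  have "log_time m L k \<le> k * (1 + m * (L + m * (k + k') + m + 1))"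
    unfolding log_time_def by (intro mult_mono add_mono) simp_all
  moreover have "log_time m (L + m * k) k' \<le> k' * (1 + m * (L + m * (k + k') + m + 1))"
    unfolding log_time_def by (simp add: algebra_simps)
  ultimately show ?thesis unfolding log_time_def by (simp add: algebra_simps)
qed

lemma log_time_mono: "k \<le> k' \<Longrightarrow> log_time m L k \<le> log_time m L k'"
  unfolding log_time_def by (intro mult_mono add_mono) simp_all

text \<open>\<open>k\<close> bounds the number of unit cost steps. The size bound \<open>m\<close> is not fixed to the size of \<open>c\<close>
  itself, so that the estimates for parts of a larger program can be added up.\<close>

definition runs :: "prog \<Rightarrow> store \<Rightarrow> nat \<Rightarrow> store \<Rightarrow> bool" where
  "runs c s k s' \<longleftrightarrow>
     (\<forall>L m. prog_size c \<le> m \<longrightarrow> bounded_store L s \<longrightarrow>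
        bounded_store (L + m * k) s' \<and> (\<exists>t. exec c s t s' \<and> t \<le> log_time m L k))"

lemma runs_mono: "runs c s k s' \<Longrightarrow> k \<le> k' \<Longrightarrow> runs c s k' s'"
  unfolding runs_def
  by (meson add_left_mono bounded_store_mono le_trans log_time_mono mult_le_mono2)

lemma runs_Skip: "runs Skip s 1 s"
  unfolding runs_def
proof (intro allI impI conjI exI)
  fix L m assume "bounded_store L s"
  then show "bounded_store (L + m * 1) s" by (rule bounded_store_mono) simp
  show "exec Skip s 1 s" by (rule exec.Skip)
  show "1 \<le> log_time m L 1" by (simp add: log_time_def)
qed

lemma runs_Assign:
  "runs (Assign a i e) s 1 (s(a := (s a)(eval_expr i s := eval_expr e s)))"
  unfolding runs_def
proof (intro allI impI conjI exI)
  fix L m assume m: "prog_size (Assign a i e) \<le> m" and L: "bounded_store L s"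
  have "eval_expr e s \<le> 2 ^ (L + expr_size e)" by (rule eval_expr_le[OF L])
  also have "\<dots> \<le> 2 ^ (L + m * 1)" using m by (intro power_increasing) simp_all
  finally show "bounded_store (L + m * 1) (s(a := (s a)(eval_expr i s := eval_expr e s)))"
    using bounded_store_mono[OF L, of "L + m * 1"] by (simp add: bounded_store_def)
  show "exec (Assign a i e) s (1 + expr_time i s + expr_time e s)
      (s(a := (s a)(eval_expr i s := eval_expr e s)))"
    by (rule exec.Assign)
  have "expr_time i s + expr_time e s \<le> (expr_size i + expr_size e) * (L + m + 1)"
    using expr_time_le[OF L, of i m] expr_time_le[OF L, of e m] m by (simp add: algebra_simps)
  also have "\<dots> \<le> m * (L + m * 1 + m + 1)" using m by (intro mult_mono) simp_all
  finally show "1 + expr_time i s + expr_time e s \<le> log_time m L 1"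
    by (simp add: log_time_def)
qed

lemma runs_Seq:
  assumes "runs c s k s'" "runs c' s' k' s''"
  shows "runs (Seq c c') s (k + k') s''"
  unfolding runs_def
proof (intro allI impI)
  fix L m assume m: "prog_size (Seq c c') \<le> m" and L: "bounded_store L s"
  have m': "prog_size c \<le> m" "prog_size c' \<le> m" using m by simp_all
  obtain t where t: "exec c s t s'" "t \<le> log_time m L k" and L': "bounded_store (L + m * k) s'"
    using assms(1) m'(1) L unfolding runs_def by blast
  obtain t' where t': "exec c' s' t' s''" "t' \<le> log_time m (L + m * k) k'"
    and L'': "bounded_store (L + m * k + m * k') s''"
    using assms(2) m'(2) L' unfolding runs_def by blast
  have "exec (Seq c c') s (t + t') s''" using t(1) t'(1) by (rule exec.Seq)
  moreover have "t + t' \<le> log_time m L (k + k')"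
    using t(2) t'(2) log_time_add[of m L k k'] by linarith
  ultimately show "bounded_store (L + m * (k + k')) s'' \<and>
      (\<exists>t. exec (Seq c c') s t s'' \<and> t \<le> log_time m L (k + k'))"
    using L'' by (auto simp: algebra_simps)
qed

text \<open>A test leaves the store unchanged, so its cost fits into the allowance of one additional
  step.\<close>

lemma log_time_Suc:
  assumes "bounded_store L s" "expr_size b \<le> m" "t \<le> log_time m L k"
  shows "1 + expr_time b s + t \<le> log_time m L (Suc k)"
proof -
  have "expr_time b s \<le> expr_size b * (L + m + 1)" using assms by (intro expr_time_le)
  also have "\<dots> \<le> m * (L + m * Suc k + m + 1)" using assms(2) by (intro mult_mono) simp_all
  finally have "1 + expr_time b s \<le> 1 + m * (L + m * Suc k + m + 1)" by simp
  moreover have "t \<le> k * (1 + m * (L + m * Suc k + m + 1))"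
    using assms(3) unfolding log_time_def
    by (rule order_trans) (intro mult_mono add_mono, simp_all)
  ultimately show ?thesis by (simp add: log_time_def)
qed

lemma runs_Cond:
  assumes "runs (if eval_expr b s \<noteq> 0 then c else c') s k s'"
  shows "runs (Cond b c c') s (Suc k) s'"
  unfolding runs_def
proof (intro allI impI)
  fix L m assume m: "prog_size (Cond b c c') \<le> m" and L: "bounded_store L s"
  have "prog_size (if eval_expr b s \<noteq> 0 then c else c') \<le> m" using m by simp
  then obtain t where t: "exec (if eval_expr b s \<noteq> 0 then c else c') s t s'"
      "t \<le> log_time m L k" and L': "bounded_store (L + m * k) s'"
    using assms L unfolding runs_def by blast
  have "exec (Cond b c c') s (1 + expr_time b s + t) s'"
    using t(1) exec.CondTrue[of b s c t s' c'] exec.CondFalse[of b s c' t s' c]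
    by (cases "eval_expr b s = 0") simp_all
  moreover have "1 + expr_time b s + t \<le> log_time m L (Suc k)"
    using L m t(2) by (intro log_time_Suc) simp_all
  ultimately show "bounded_store (L + m * Suc k) s' \<and>
      (\<exists>t. exec (Cond b c c') s t s' \<and> t \<le> log_time m L (Suc k))"
    using bounded_store_mono[OF L', of "L + m * Suc k"] by auto
qed

lemma runs_WhileFalse: "eval_expr b s = 0 \<Longrightarrow> runs (While b c) s 1 s"
  unfolding runs_def
proof (intro allI impI conjI exI)
  fix L m assume b: "eval_expr b s = 0" and m: "prog_size (While b c) \<le> m"
    and L: "bounded_store L s"
  show "bounded_store (L + m * 1) s" using L by (rule bounded_store_mono) simp
  show "exec (While b c) s (1 + expr_time b s) s" using b by (rule exec.WhileFalse)
  show "1 + expr_time b s \<le> log_time m L 1"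
    using log_time_Suc[OF L, of b m 0 0] m by simp
qed

lemma runs_WhileTrue:
  assumes "eval_expr b s \<noteq> 0" "runs c s k s'" "runs (While b c) s' k' s''"
  shows "runs (While b c) s (Suc (k + k')) s''"
  unfolding runs_def
proof (intro allI impI)
  fix L m assume m: "prog_size (While b c) \<le> m" and L: "bounded_store L s"
  have m': "prog_size c \<le> m" using m by simp
  obtain t where t: "exec c s t s'" "t \<le> log_time m L k" and L': "bounded_store (L + m * k) s'"
    using assms(2) m' L unfolding runs_def by blast
  obtain t' where t': "exec (While b c) s' t' s''" "t' \<le> log_time m (L + m * k) k'"
    and L'': "bounded_store (L + m * k + m * k') s''"
    using assms(3) m L' unfolding runs_def by blast
  have "exec (While b c) s (1 + expr_time b s + t + t') s''"
    using assms(1) t(1) t'(1) by (rule exec.WhileTrue)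
  moreover have "t + t' \<le> log_time m L (k + k')"
    using t(2) t'(2) log_time_add[of m L k k'] by linarith
  then have "1 + expr_time b s + (t + t') \<le> log_time m L (Suc (k + k'))"
    using L m by (intro log_time_Suc) simp_all
  moreover have "bounded_store (L + m * Suc (k + k')) s''"
    by (rule bounded_store_mono[OF L'']) (simp add: algebra_simps)
  ultimately show "bounded_store (L + m * Suc (k + k')) s'' \<and>
      (\<exists>t. exec (While b c) s t s'' \<and> t \<le> log_time m L (Suc (k + k')))"
    by (auto simp: add.assoc)
qed

text \<open>The sequence \<open>f\<close> of stores at the loop head takes the place of an
  invariant; each iteration pays one extra step for the test.\<close>

lemma runs_While:
  assumes "\<And>i. i < n \<Longrightarrow> eval_expr b (f i) \<noteq> 0"
    and "\<And>i. i < n \<Longrightarrow> runs c (f i) k (f (Suc i))"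
    and "eval_expr b (f n) = 0"
  shows "runs (While b c) (f 0) (n * (k + 1) + 1) (f n)"
  using assms
proof (induction n arbitrary: f)
  case 0
  then show ?case by (simp add: runs_WhileFalse[simplified])
next
  case (Suc n)
  have "runs (While b c) (f (Suc 0)) (n * (k + 1) + 1) (f (Suc n))"
    using Suc.IH[of "\<lambda>i. f (Suc i)"] Suc.prems by simp
  from runs_WhileTrue[OF _ _ this, of "f 0" k] Suc.prems(1,2)[of 0]
  show ?case by (simp add: algebra_simps)
qed

section \<open>Symbolic execution of loop-free programs\<close>

fun loop_free :: "prog \<Rightarrow> bool" where
  "loop_free Skip = True"
| "loop_free (Assign a i e) = True"
| "loop_free (Seq c c') = (loop_free c \<and> loop_free c')"
| "loop_free (Cond b c c') = (loop_free c \<and> loop_free c')"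
| "loop_free (While b c) = False"

text \<open>Turns execution into a function that the simplifier can evaluate symbolically.\<close>

fun straight :: "prog \<Rightarrow> store \<Rightarrow> store" where
  "straight Skip s = s"
| "straight (Assign a i e) s = s(a := (s a)(eval_expr i s := eval_expr e s))"
| "straight (Seq c c') s = straight c' (straight c s)"
| "straight (Cond b c c') s = (if eval_expr b s \<noteq> 0 then straight c s else straight c' s)"
| "straight (While b c) s = s"

fun straight_steps :: "prog \<Rightarrow> nat" where
  "straight_steps (Seq c c') = straight_steps c + straight_steps c'"
| "straight_steps (Cond b c c') = Suc (max (straight_steps c) (straight_steps c'))"
| "straight_steps c = 1"

lemma runs_straight: "loop_free c \<Longrightarrow> runs c s (straight_steps c) (straight c s)"
proof (induction c arbitrary: s)
  case Skip
  then show ?case using runs_Skip by simp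
next
  case (Assign a i e)
  show ?case using runs_Assign[of a i e s] by (simp add: fun_upd_def)
next
  case (Seq c c')
  from runs_Seq[OF Seq.IH] show ?case using Seq.prems by simp
next
  case (Cond b c c')
  have "runs (if eval_expr b s \<noteq> 0 then c else c') s (max (straight_steps c) (straight_steps c'))
      (straight (Cond b c c') s)"
    using Cond.IH[of s] Cond.prems by (auto elim: runs_mono)
  then show ?case using runs_Cond by simp
qed simp

lemma runs_straightI:
  "straight c s = s' \<Longrightarrow> loop_free c \<Longrightarrow> straight_steps c \<le> k \<Longrightarrow> runs c s k s'"
  using runs_straight runs_mono by blast

lemma polytime_decidableI:
  assumes "\<And>x w. x \<in> inputs \<Longrightarrow> w \<in> enc x \<Longrightarrow>
    \<exists>s. runs c (initial_store w) (poly q (length w)) s \<and> s 1 0 = (if yes x then 1 else 0)"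
  shows "polytime_decidable enc inputs yes"
proof -
  define m where "m = prog_size c"
  \<comment> \<open>\<open>T\<close> is \<open>log_time m 2\<close> with the polynomial
    \<open>q\<close> in place of the step count. The start length is 2 because symbol codes are
    below \<open>2 ^ 2\<close>.\<close>
  define T where "T = q * (1 + [:m:] * ([:2:] + [:m:] * q + [:m:] + 1))"
  have T: "poly T n = log_time m 2 (poly q n)" for n
    by (simp add: T_def log_time_def)
  have "\<exists>t s. exec c (initial_store w) t s \<and> t \<le> poly T (length w) \<and>
      s 1 0 = (if yes x then 1 else 0)" if x: "x \<in> inputs" "w \<in> enc x" for x w
  proof -
    obtain s where s: "runs c (initial_store w) (poly q (length w)) s"
      "s 1 0 = (if yes x then 1 else 0)"
      using assms[OF x] by blast
    have "symbol_code z \<le> 4" for z by (cases z) simp_all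
    then have "bounded_store 2 (initial_store w)"
      by (simp add: bounded_store_def initial_store_def)
    then obtain t where "exec c (initial_store w) t s" "t \<le> log_time m 2 (poly q (length w))"
      using s(1) unfolding runs_def m_def by blast
    then show ?thesis using s(2) unfolding T by blast
  qed
  then show ?thesis unfolding polytime_decidable_def by blast
qed

section \<open>Greedy selection after deletions\<close>

definition greedy_cost :: "('p, 'v) pb \<Rightarrow> 'p \<Rightarrow> nat \<Rightarrow> nat" where
  "greedy_cost E q c = (if c + cost E q \<le> budget E then c + cost E q else c)"

lemma greedy_step_total_cost:
  "finite W \<Longrightarrow> q \<notin> W \<Longrightarrow> total_cost E (greedy_step E q W) = greedy_cost E q (total_cost E W)"
  by (simp add: greedy_step_def greedy_cost_def total_cost_def)

text \<open>As \<open>qs\<close> has no repetitions and is disjoint from \<open>W\<close>, every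
  insertion adds a new project, and the cost alone determines the next step.\<close>

lemma fold_greedy_step_total_cost:
  "distinct qs \<Longrightarrow> finite W \<Longrightarrow> W \<inter> set qs = {} \<Longrightarrow>
    total_cost E (fold (greedy_step E) qs W) = fold (greedy_cost E) qs (total_cost E W)"
proof (induction qs arbitrary: W)
  case (Cons q qs)
  have "total_cost E (fold (greedy_step E) qs (greedy_step E q W)) =
      fold (greedy_cost E) qs (total_cost E (greedy_step E q W))"
    using Cons.prems by (intro Cons.IH) (auto simp: greedy_step_def)
  then show ?case using Cons.prems by (simp add: greedy_step_total_cost)
qed simp

lemma fold_greedy_step_member:
  "p \<notin> set qs \<Longrightarrow> p \<in> fold (greedy_step E) qs W \<longleftrightarrow> p \<in> W"
  by (induction qs arbitrary: W) (auto simp: greedy_step_def)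

text \<open>Only the step for \<open>p\<close> itself can change the membership of \<open>p\<close>,
  and its outcome depends on the cost reached just before.\<close>

lemma greedyAV_member:
  assumes "distinct (projects E)" "processing_order E = xs @ p # ys"
  shows "p \<in> greedyAV E \<longleftrightarrow> fold (greedy_cost E) xs 0 + cost E p \<le> budget E"
proof -
  have "distinct (xs @ p # ys)"
    using assms by (metis distinct_sort processing_order_def)
  then have d: "distinct xs" "p \<notin> set xs" "p \<notin> set ys" by auto
  have "total_cost E (fold (greedy_step E) xs {}) = fold (greedy_cost E) xs 0"
    using fold_greedy_step_total_cost[OF d(1), of "{}"] by (simp add: total_cost_def)
  then show ?thesis
    using fold_greedy_step_member[OF d(2), of E "{}"]
    by (simp add: greedyAV_def assms(2) fold_greedy_step_member[OF d(3)])
      (simp add: greedy_step_def)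
qed

text \<open>Insertion sort uses its keys only in comparisons, so even keys of different types may be
  exchanged.\<close>

lemma sort_key_cong_le:
  fixes f :: "'a \<Rightarrow> 'b :: linorder" and g :: "'a \<Rightarrow> 'c :: linorder"
  assumes "\<And>x y. x \<in> set xs \<Longrightarrow> y \<in> set xs \<Longrightarrow> f x \<le> f y \<longleftrightarrow> g x \<le> g y"
  shows "sort_key f xs = sort_key g xs"
  using assms
proof (induction xs)
  case (Cons x xs)
  have "insort_key f x ys = insort_key g x ys" if "set ys \<subseteq> set xs" for ys
    using that Cons.prems by (induction ys) auto
  from this[of "sort_key g xs"] show ?case using Cons by simp
qed simp

text \<open>The remaining projects retain their scores, and stable sorting commutes with
  filtering.\<close>

lemma processing_order_delete:
  "processing_order (delete_projects D E) = filter (\<lambda>q. q \<notin> D) (processing_order E)"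
proof -
  let ?ps = "filter (\<lambda>q. q \<notin> D) (projects E)"
  have "score_AV (delete_projects D E) q = score_AV E q" if "q \<notin> D" for q
    using that by (simp add: score_AV_def delete_projects_def)
  then have "sort_key (\<lambda>p. - int (score_AV (delete_projects D E) p)) ?ps =
      sort_key (\<lambda>p. - int (score_AV E p)) ?ps"
    by (intro sort_key_cong_le) simp
  then show ?thesis
    by (simp add: processing_order_def filter_sort) (simp add: delete_projects_def)
qed

lemma greedyAV_delete_member:
  assumes "distinct (projects E)" "processing_order E = xs @ p # ys" "p \<notin> D"
  shows "p \<in> greedyAV (delete_projects D E) \<longleftrightarrow>
    fold (greedy_cost E) (filter (\<lambda>q. q \<notin> D) xs) 0 + cost E p \<le> budget E"
proof -
  have "greedy_cost (delete_projects D E) = greedy_cost E"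
    by (simp add: fun_eq_iff greedy_cost_def delete_projects_def)
  then show ?thesis
    using greedyAV_member[of "delete_projects D E" "filter (\<lambda>q. q \<notin> D) xs" p
        "filter (\<lambda>q. q \<notin> D) ys"] assms
    by (simp add: processing_order_delete) (simp add: delete_projects_def)
qed

section \<open>The dynamic program over the cost of the funded projects\<close>

text \<open>There are two ways to end at cost \<open>c\<close>: without funding the project, where
  its deletion is paid with \<open>w\<close> unless it does not fit anyway, or by funding it on top
  of \<open>c - k\<close>.\<close>

definition dp_step :: "nat \<Rightarrow> nat \<Rightarrow> nat \<Rightarrow> (nat \<Rightarrow> nat) \<Rightarrow> nat \<Rightarrow> nat" where
  "dp_step B k w g c =
     max (if c + k \<le> B then g c - w else g c) (if k \<le> c \<and> c \<le> B then g (c - k) else 0)"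

definition dp_table :: "('p, 'v) pb \<Rightarrow> ('p \<Rightarrow> nat) \<Rightarrow> nat \<Rightarrow> 'p list \<Rightarrow> nat \<Rightarrow> nat" where
  "dp_table E w r qs =
     fold (\<lambda>q. dp_step (budget E) (cost E q) (w q)) qs ((\<lambda>_. 0)(0 := r + 1))"

lemma dp_table_Nil: "dp_table E w r [] = (\<lambda>_. 0)(0 := r + 1)"
  by (simp add: dp_table_def)

lemma dp_table_snoc:
  "dp_table E w r (qs @ [q]) = dp_step (budget E) (cost E q) (w q) (dp_table E w r qs)"
  by (simp add: dp_table_def)

text \<open>No run can spend more than all projects cost together. Hence a finite stretch of memory
  can hold the whole table.\<close>

lemma dp_table_eq_0: "sum_list (map (cost E) qs) < c \<Longrightarrow> dp_table E w r qs c = 0"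
  by (induction qs arbitrary: c rule: rev_induct)
    (auto simp: dp_table_Nil dp_table_snoc dp_step_def)

text \<open>An entry of the table is one more than the largest part of the bound that can be left over,
  and \<open>0\<close> if the cost is not attainable: truncated subtraction then discards too expensive
  deletions by itself.\<close>

lemma le_dp_table_iff:
  assumes "distinct qs" "\<And>q. q \<in> set qs \<Longrightarrow> 1 \<le> cost E q" "1 \<le> x"
  shows "x \<le> dp_table E w r qs c \<longleftrightarrow>
    (\<exists>D \<subseteq> set qs. x + sum w D \<le> r + 1 \<and> fold (greedy_cost E) (filter (\<lambda>q. q \<notin> D) qs) 0 = c)"
  using assms
proof (induction qs arbitrary: x c rule: rev_induct)
  case Nil
  then show ?case by (auto simp: dp_table_Nil)
next
  case (snoc q qs)
  let ?G = "dp_table E w r qs" and ?k = "cost E q" and ?B = "budget E"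
  let ?F = "\<lambda>D. fold (greedy_cost E) (filter (\<lambda>q. q \<notin> D) qs) 0"
  have q: "q \<notin> set qs" and k: "1 \<le> ?k" using snoc.prems by auto
  have IH: "x \<le> ?G c \<longleftrightarrow> (\<exists>D \<subseteq> set qs. x + sum w D \<le> r + 1 \<and> ?F D = c)" if "1 \<le> x" for x c
    using snoc that by simp
  \<comment> \<open>The last project is deleted in \<open>?R1\<close> and kept in
    \<open>?R2\<close>.\<close>
  have "(\<exists>D \<subseteq> set (qs @ [q]). x + sum w D \<le> r + 1 \<and>
        fold (greedy_cost E) (filter (\<lambda>q. q \<notin> D) (qs @ [q])) 0 = c) \<longleftrightarrow>
      (\<exists>D \<subseteq> set qs. x + w q + sum w D \<le> r + 1 \<and> ?F D = c) \<or>
      (\<exists>D \<subseteq> set qs. x + sum w D \<le> r + 1 \<and> greedy_cost E q (?F D) = c)"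
    (is "?L \<longleftrightarrow> ?R1 \<or> ?R2")
  proof
    assume ?L
    then obtain D where D: "D \<subseteq> insert q (set qs)" "x + sum w D \<le> r + 1"
      "fold (greedy_cost E) (filter (\<lambda>q. q \<notin> D) (qs @ [q])) 0 = c" by auto
    show "?R1 \<or> ?R2"
    proof (cases "q \<in> D")
      case True
      have "finite D" using D(1) by (rule finite_subset) simp
      then have "sum w D = w q + sum w (D - {q})" using True by (simp add: sum.remove)
      moreover have "filter (\<lambda>q'. q' \<notin> D) qs = filter (\<lambda>q'. q' \<notin> D - {q}) qs"
        using q by (intro filter_cong) auto
      ultimately have ?R1 using D True by (intro exI[of _ "D - {q}"]) auto
      then show ?thesis ..
    next
      case False
      then have ?R2 using D by (intro exI[of _ D]) auto
      then show ?thesis ..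
    qed
  next
    assume "?R1 \<or> ?R2"
    then show ?L
    proof
      assume ?R1
      then obtain D where D: "D \<subseteq> set qs" "x + w q + sum w D \<le> r + 1" "?F D = c" by blast
      have "finite D" using D(1) by (rule finite_subset) simp
      moreover have "q \<notin> D" using D(1) q by blast
      moreover have "filter (\<lambda>q'. q' \<notin> insert q D) qs = filter (\<lambda>q'. q' \<notin> D) qs"
        using q by (intro filter_cong) auto
      ultimately show ?L using D by (intro exI[of _ "insert q D"]) auto
    next
      assume ?R2
      then obtain D where D: "D \<subseteq> set qs" "x + sum w D \<le> r + 1" "greedy_cost E q (?F D) = c"
        by blast
      moreover have "q \<notin> D" using D(1) q by blast
      ultimately show ?L by (intro exI[of _ D]) auto
    qed
  qed
  also have "?R1 \<longleftrightarrow> x + w q \<le> ?G c" using IH[of "x + w q" c] snoc.prems by simp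
  also have "?R2 \<longleftrightarrow> (\<exists>c'. x \<le> ?G c' \<and> greedy_cost E q c' = c)"
    unfolding IH[OF snoc.prems(3)] by metis
  \<comment> \<open>In \<open>?R3\<close> the project is funded, in \<open>?R4\<close> it does not
    fit and is skipped.\<close>
  also have "\<dots> \<longleftrightarrow> (?k \<le> c \<and> c \<le> ?B \<and> x \<le> ?G (c - ?k)) \<or> (?B < c + ?k \<and> x \<le> ?G c)"
    (is "?R \<longleftrightarrow> ?R3 \<or> ?R4")
  proof
    show "?R3 \<or> ?R4" if ?R using that by (auto simp: greedy_cost_def split: if_splits)
    show ?R if "?R3 \<or> ?R4"
      using that
    proof
      assume ?R3
      then show ?R by (intro exI[of _ "c - ?k"]) (simp add: greedy_cost_def)
    next
      assume ?R4
      then show ?R by (intro exI[of _ c]) (simp add: greedy_cost_def)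
    qed
  qed
  \<comment> \<open>\<open>1 \<le> x\<close> turns the truncated subtraction into
    \<open>x + w q \<le> ?G c\<close> and excludes the default entry 0. If \<open>q\<close> does not
    fit, then \<open>?R1\<close> implies \<open>?R4\<close>, which matches the free skip in
    \<open>dp_step\<close>.\<close>
  finally show ?case
    using snoc.prems k by (auto simp: dp_table_snoc dp_step_def le_max_iff_disj)
qed

text \<open>Comparing with \<open>destr\<close> negates a condition exactly when
  \<open>destr\<close> is true, so constructive and destructive control share one proof.\<close>

lemma control_iff_dp_table:
  assumes "pb_instance (election I)" "processing_order (election I) = xs @ target I # ys"
  shows "(\<exists>D \<in> deletion_sets I.
      (target I \<in> greedyAV (delete_projects D (election I))) \<noteq> destr) \<longleftrightarrow>
    (\<exists>c. dp_table (election I) (weight I) (bound I) xs c \<noteq> 0 \<and>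
      (c + cost (election I) (target I) \<le> budget (election I)) \<noteq> destr)"
proof -
  let ?E = "election I" and ?p = "target I"
  let ?F = "\<lambda>D. fold (greedy_cost ?E) (filter (\<lambda>q. q \<notin> D) xs) 0"
  let ?ok = "\<lambda>c. (c + cost ?E ?p \<le> budget ?E) \<noteq> destr"
  have dist: "distinct (projects ?E)" using assms(1) by (simp add: pb_instance_def)
  have set_eq: "set (xs @ ?p # ys) = set (projects ?E)"
    using assms(2) by (metis set_sort processing_order_def)
  have "distinct (xs @ ?p # ys)"
    using assms(2) dist by (metis distinct_sort processing_order_def)
  then have xs: "distinct xs" "?p \<notin> set xs" by auto
  have cost_pos: "1 \<le> cost ?E q" if "q \<in> set xs" for q
    using that set_eq assms(1) by (auto simp: pb_instance_def)
  have funded: "?p \<in> greedyAV (delete_projects D ?E) \<longleftrightarrow> ?F D + cost ?E ?p \<le> budget ?E"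
    if "?p \<notin> D" for D
    using greedyAV_delete_member[OF dist assms(2) that] .
  \<comment> \<open>For \<open>x = 1\<close> the inequality of \<open>le_dp_table_iff\<close>
    becomes the weight bound.\<close>
  have "dp_table ?E (weight I) (bound I) xs c \<noteq> 0 \<longleftrightarrow>
      (\<exists>D \<subseteq> set xs. sum (weight I) D \<le> bound I \<and> ?F D = c)" for c
    using le_dp_table_iff[OF xs(1) cost_pos, of 1 "weight I" "bound I" c]
    by (simp add: Suc_le_eq less_Suc_eq_le)
  then have "(\<exists>c. dp_table ?E (weight I) (bound I) xs c \<noteq> 0 \<and> ?ok c) \<longleftrightarrow>
      (\<exists>D \<subseteq> set xs. sum (weight I) D \<le> bound I \<and> ?ok (?F D))"
    by (simp only:) blast
  also have "\<dots> \<longleftrightarrow> (\<exists>D \<in> deletion_sets I. ?ok (?F D))"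
  proof
    assume "\<exists>D \<subseteq> set xs. sum (weight I) D \<le> bound I \<and> ?ok (?F D)"
    then show "\<exists>D \<in> deletion_sets I. ?ok (?F D)"
      using set_eq xs(2) by (fastforce simp: deletion_sets_def)
  next
    assume "\<exists>D \<in> deletion_sets I. ?ok (?F D)"
    then obtain D where D: "D \<subseteq> set (projects ?E)" "sum (weight I) D \<le> bound I" "?ok (?F D)"
      by (auto simp: deletion_sets_def)
    \<comment> \<open>Deletions outside \<open>xs\<close> can only add weight and do not change the
      greedy run before the target, so \<open>D \<inter> set xs\<close> serves as well as
      \<open>D\<close>.\<close>
    have "finite D" using D(1) by (rule finite_subset) simp
    then have "sum (weight I) (D \<inter> set xs) \<le> bound I"
      using sum_mono2[of D "D \<inter> set xs" "weight I"] D(2) by simp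
    moreover have "filter (\<lambda>q. q \<notin> D \<inter> set xs) xs = filter (\<lambda>q. q \<notin> D) xs"
      by (intro filter_cong) auto
    ultimately show "\<exists>D \<subseteq> set xs. sum (weight I) D \<le> bound I \<and> ?ok (?F D)"
      using D(3) by (intro exI[of _ "D \<inter> set xs"]) auto
  qed
  also have "\<dots> \<longleftrightarrow> (\<exists>D \<in> deletion_sets I. (?p \<in> greedyAV (delete_projects D ?E)) \<noteq> destr)"
    using funded by (intro bex_cong refl) (auto simp: deletion_sets_def)
  finally show ?thesis ..
qed

section \<open>The processing order by bucket sort\<close>

definition disapproval :: "('p, 'v) pb \<Rightarrow> 'p \<Rightarrow> nat" where
  "disapproval E p = card {v \<in> voters E. p \<notin> approves E v}"

text \<open>Score and disapproval sum to the number of voters, so decreasing score is increasing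
  disapproval. The new key is a natural number and can index buckets.\<close>

lemma processing_order_disapproval:
  assumes "finite (voters E)"
  shows "processing_order E = sort_key (disapproval E) (projects E)"
proof -
  have "score_AV E p + disapproval E p = card (voters E)" for p
  proof -
    have "voters E = {v \<in> voters E. p \<in> approves E v} \<union> {v \<in> voters E. p \<notin> approves E v}"
      by auto
    then show ?thesis unfolding score_AV_def disapproval_def
      using assms by (metis (no_types, lifting) card_Un_disjoint finite_Un disjoint_iff mem_Collect_eq)
  qed
  from this have "- int (score_AV E x) = int (disapproval E x) - int (card (voters E))" for x
    by (simp flip: of_nat_add add: algebra_simps)
  then show ?thesis
    unfolding processing_order_def by (intro sort_key_cong_le) simp
qed

lemma filter_less_Suc_sorted:
  fixes f :: "'a \<Rightarrow> nat"
  assumes "sorted (map f xs)"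
  shows "filter (\<lambda>x. f x < Suc d) xs = filter (\<lambda>x. f x < d) xs @ filter (\<lambda>x. f x = d) xs"
  using assms
proof (induction xs)
  case (Cons x xs)
  have "filter (\<lambda>y. f y < d) xs = []" if "\<not> f x < d"
    using that Cons.prems by (auto simp: filter_empty_conv)
  moreover have "filter (\<lambda>y. f y < d) xs = []" "filter (\<lambda>y. f y = d) xs = []"
    if "d < f x" using that Cons.prems by (auto simp: filter_empty_conv)
  ultimately show ?case using Cons by (auto simp: less_Suc_eq)
qed simp

lemma append_filter_sorted:
  fixes f :: "'a \<Rightarrow> nat"
  assumes "sorted (map f xs)"
  shows "xs = filter (\<lambda>x. f x < d) xs @ filter (\<lambda>x. \<not> f x < d) xs"
  using assms
proof (induction xs)
  case (Cons x xs)
  have "filter (\<lambda>y. f y < d) xs = []" if "\<not> f x < d"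
    using that Cons.prems by (auto simp: filter_empty_conv)
  then show ?case using Cons by auto
qed simp

text \<open>By stability each bucket of the sorted list keeps the order of
  \<open>xs\<close>.\<close>

lemma filter_less_sort_key:
  fixes f :: "'a \<Rightarrow> nat"
  shows "filter (\<lambda>x. f x < d) (sort_key f xs) = concat (map (\<lambda>d. filter (\<lambda>x. f x = d) xs) [0..<d])"
  by (induction d) (simp_all add: filter_less_Suc_sorted sort_key_stable)

text \<open>Stability also settles the bucket of \<open>xs ! t\<close>: its members ahead of
  \<open>xs ! t\<close> are those ahead of it in \<open>xs\<close>. The prefix can thus be listed by
  one scan of \<open>xs\<close> per key.\<close>

lemma sort_key_buckets:
  fixes f :: "'a \<Rightarrow> nat"
  assumes "t < length xs"
  defines "d \<equiv> f (xs ! t)"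
  shows "\<exists>ys. sort_key f xs = concat (map (\<lambda>d. filter (\<lambda>x. f x = d) xs) [0..<d]) @
    filter (\<lambda>x. f x = d) (take t xs) @ xs ! t # ys"
proof -
  let ?s = "sort_key f xs" and ?take = "filter (\<lambda>x. f x = d) (take t xs)"
    and ?drop = "filter (\<lambda>x. f x = d) (drop (Suc t) xs)"
    and ?low = "concat (map (\<lambda>d. filter (\<lambda>x. f x = d) xs) [0..<d])"
    and ?high = "filter (\<lambda>x. \<not> f x < Suc d) (sort_key f xs)"
  have split: "?s = filter (\<lambda>x. f x < Suc d) ?s @ ?high"
    by (rule append_filter_sorted) simp
  have low: "filter (\<lambda>x. f x < Suc d) ?s = ?low @ filter (\<lambda>x. f x = d) xs"
    by (simp only: filter_less_Suc_sorted[OF sorted_sort_key] filter_less_sort_key sort_key_stable)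
  have "filter (\<lambda>x. f x = d) xs = filter (\<lambda>x. f x = d) (take t xs @ xs ! t # drop (Suc t) xs)"
    using id_take_nth_drop[OF assms(1)] by simp
  also have "\<dots> = ?take @ xs ! t # ?drop"
    by (simp only: filter_append filter.simps d_def simp_thms if_True)
  finally have "?s = ?low @ ?take @ xs ! t # (?drop @ ?high)"
    using split low by (simp only: append_assoc append_Cons)
  then show ?thesis by blast
qed

section \<open>The decision program\<close>

definition codes :: "symbol list \<Rightarrow> nat \<Rightarrow> nat" where
  "codes w i = (if i < length w then symbol_code (w ! i) else 0)"

lemma codes_append: "codes (us @ ys) (length us + i) = codes ys i"
  by (simp add: codes_def nth_append)

text \<open>The \<open>n\<close> iterations are charged as \<open>N\<close>, so that bounds can be
  stated in the input length although \<open>n\<close> counts projects, voters or digits.\<close>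

lemma runs_WhileI:
  assumes "f 0 = s" "f n = s'"
    and "\<And>i. i < n \<Longrightarrow> eval_expr b (f i) \<noteq> 0"
    and "\<And>i. i < n \<Longrightarrow> runs c (f i) k (f (Suc i))"
    and "eval_expr b (f n) = 0" "n \<le> N" "N * (k + 1) + 1 \<le> K"
  shows "runs (While b c) s K s'"
proof (rule runs_mono)
  show "runs (While b c) s (n * (k + 1) + 1) s'"
    using runs_While[of n b f c k] assms(1-5) by simp
  have "n * (k + 1) \<le> N * (k + 1)" using assms(6) by (rule mult_le_mono1)
  then show "n * (k + 1) + 1 \<le> K" using assms(7) by linarith
qed

section \<open>Program notation and the reading of numbers\<close>

abbreviation Var :: "nat \<Rightarrow> expr" where
  "Var a \<equiv> Cell a (Const 0)"

abbreviation increment :: "nat \<Rightarrow> prog" where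
  "increment a \<equiv> Assign a (Const 0) (Plus (Var a) (Const 1))"

abbreviation decrement :: "nat \<Rightarrow> prog" where
  "decrement a \<equiv> Assign a (Const 0) (Minus (Var a) (Const 1))"

abbreviation symbol_at_head :: expr where
  "symbol_at_head \<equiv> Cell 0 (Var 2)"

text \<open>Array 2 holds the reading position. The test vanishes exactly at \<open>Sep\<close>,
  whose code is 3, and a digit is one less than its code. Doubling the accumulator gives Horner's
  scheme; without doubling, a unary number is counted.\<close>

definition read_number :: "bool \<Rightarrow> nat \<Rightarrow> expr \<Rightarrow> prog" where
  "read_number binary a i =
     Seq (While (Minus (Const 3) symbol_at_head)
       (Seq (Assign a i (Plus (if binary then Plus (Cell a i) (Cell a i) else Cell a i)
              (Minus symbol_at_head (Const 1))))
         (increment 2)))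
     (increment 2)"

definition digits_value :: "bool \<Rightarrow> nat \<Rightarrow> symbol list \<Rightarrow> nat" where
  "digits_value binary x ys =
     fold (\<lambda>y x. (if binary then x + x else x) + (symbol_code y - 1)) ys x"

lemma digits_value_binary_digits: "digits_value True 0 (binary_digits n) = n"
proof (induction n rule: binary_digits.induct)
  case (1 n)
  show ?case
  proof (cases "n = 0")
    case True
    then show ?thesis by (simp add: binary_digits.simps[of 0] digits_value_def)
  next
    case False
    have "n = n div 2 + n div 2 + (if odd n then 1 else 0)" by presburger
    moreover have "digits_value True 0 (binary_digits n) =
        n div 2 + n div 2 + (if odd n then 1 else 0)"
      using 1[OF False] False
      by (simp add: binary_digits.simps[of n] digits_value_def bit_symbol_def)
    ultimately show ?thesis by simp
  qed
qed

lemma digits_value_replicate: "digits_value False x (replicate n One) = x + n"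
  by (induction n arbitrary: x) (simp_all add: digits_value_def)

lemma Sep_notin_binary_digits: "Sep \<notin> set (binary_digits n)"
proof (induction n rule: binary_digits.induct)
  case (1 n)
  then show ?case
    by (subst binary_digits.simps) (simp add: bit_symbol_def)
qed

text \<open>By hypothesis \<open>i\<close> the address does not depend on the two arrays written by
  the loop, so every iteration accesses the same cell \<open>v\<close>.\<close>

lemma runs_read_number:
  assumes "s 0 = codes w" "w = us @ ys @ Sep # vs" "s 2 0 = length us" "Sep \<notin> set ys"
    and a: "a \<noteq> 0" "a \<noteq> 2" and i: "\<And>f g. eval_expr i (s(a := f, 2 := g)) = v"
    and s': "s' = s(a := (s a)(v := digits_value binary (s a v) ys),
      2 := (s 2)(0 := length us + length ys + 1))"
    and k: "length w * 3 + 2 \<le> k"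
  shows "runs (read_number binary a i) s k s'"
proof -
  define f where "f l = s(a := (s a)(v := digits_value binary (s a v) (take l ys)),
      2 := (s 2)(0 := length us + l))" for l
  let ?body = "Seq (Assign a i (Plus (if binary then Plus (Cell a i) (Cell a i) else Cell a i)
              (Minus symbol_at_head (Const 1)))) (increment 2)"
  have head: "eval_expr symbol_at_head (f l) = codes (ys @ Sep # vs) l" for l
    using a by (simp add: f_def assms(1) assms(2) codes_append)
  have index: "eval_expr i (f l) = v" "eval_expr i ((f l)(a := g)) = v" for l g
    using a i[of _ "(s 2)(0 := length us + l)"] by (simp_all add: f_def fun_upd_twist)
  have f0: "f 0 = s" using assms(3) a by (auto simp: f_def digits_value_def fun_upd_def fun_eq_iff)
  have step: "straight ?body (f l) = f (Suc l)" if "l < length ys" for l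
  proof -
    have "digits_value binary (s a v) (take (Suc l) ys) =
        (let x = digits_value binary (s a v) (take l ys) in
          (if binary then x + x else x) + (codes (ys @ Sep # vs) l - 1))"
      using that
      by (simp add: take_Suc_conv_app_nth digits_value_def codes_def nth_append Let_def)
    moreover have "f l a v = digits_value binary (s a v) (take l ys)"
      "f l 2 0 = length us + l" using a by (simp_all add: f_def)
    ultimately have "straight ?body (f l) =
        (f l)(a := (f l a)(v := digits_value binary (s a v) (take (Suc l) ys)),
          2 := (f l 2)(0 := length us + Suc l))"
      using a head[of l] index by (cases binary) (simp_all add: Let_def)
    then show ?thesis using a by (simp add: f_def fun_eq_iff)
  qed
  have "runs (While (Minus (Const 3) symbol_at_head) ?body) s (length ys * 3 + 1)
      (f (length ys))"
  proof (rule runs_WhileI[where f = f and n = "length ys" and N = "length ys" and k = 2, OF f0 refl])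
    show "eval_expr (Minus (Const 3) symbol_at_head) (f l) \<noteq> 0" if "l < length ys" for l
    proof -
      have "ys ! l \<noteq> Sep" using assms(4) that by (metis nth_mem)
      then show ?thesis unfolding eval_expr.simps(4) head using that
        by (cases "ys ! l") (simp_all add: codes_def nth_append)
    qed
    show "runs ?body (f l) 2 (f (Suc l))" if "l < length ys" for l
      by (rule runs_straightI[OF step[OF that]]) simp_all
    show "eval_expr (Minus (Const 3) symbol_at_head) (f (length ys)) = 0"
      unfolding eval_expr.simps(4) head by (simp add: codes_def)
  qed simp_all
  moreover have "runs (increment 2) (f (length ys)) 1 s'"
    by (rule runs_straightI) (simp_all add: s' f_def)
  ultimately have "runs (read_number binary a i) s (length ys * 3 + 1 + 1) s'"
    unfolding read_number_def by (rule runs_Seq)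
  then show ?thesis by (rule runs_mono) (use k assms(2) in simp)
qed

section \<open>The memory of the program\<close>

text \<open>Models an array being filled from the left, with the initial 0 in the cells not yet
  reached.\<close>

definition segment :: "nat \<Rightarrow> (nat \<Rightarrow> nat) \<Rightarrow> nat \<Rightarrow> nat" where
  "segment n F j = (if j < n then F j else 0)"

lemma segment_0 [simp]: "segment 0 F = (\<lambda>_. 0)"
  by (simp add: segment_def fun_eq_iff)

lemma segment_nth [simp]: "j < n \<Longrightarrow> segment n F j = F j" "segment n F n = 0"
  by (simp_all add: segment_def)

lemma segment_update [simp]: "y = F n \<Longrightarrow> (segment n F)(n := y) = segment (Suc n) F"
  by (auto simp: segment_def fun_eq_iff)

text \<open>A record view of the memory, with one field for each array of the program; fields of type
  \<open>nat\<close> are the arrays of which only cell \<open>0\<close> is used.\<close>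

record ram =
  r_inp :: "nat \<Rightarrow> nat"
  r_ans :: nat
  r_pos :: nat
  r_budget :: nat
  r_bound :: nat
  r_num :: nat
  r_target :: nat
  r_costs :: "nat \<Rightarrow> nat"
  r_weights :: "nat \<Rightarrow> nat"
  r_keys :: "nat \<Rightarrow> nat"
  r_index :: nat
  r_key :: nat
  r_entry :: nat
  r_table :: "nat \<Rightarrow> nat"
  r_limit :: nat

definition cell :: "nat \<Rightarrow> nat \<Rightarrow> nat" where
  "cell x = (\<lambda>_. 0)(0 := x)"

lemma cell_simps [simp]: "cell x 0 = x" "(cell x)(0 := y) = cell y"
  by (simp_all add: cell_def)

definition to_store :: "ram \<Rightarrow> store" where
  "to_store S = (\<lambda>_ _. 0)(0 := r_inp S, 1 := cell (r_ans S), 2 := cell (r_pos S),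
     3 := cell (r_budget S), 4 := cell (r_bound S), 5 := cell (r_num S),
     6 := cell (r_target S), 7 := r_costs S, 8 := r_weights S, 9 := r_keys S,
     10 := cell (r_index S), 11 := cell (r_key S), 12 := cell (r_entry S), 13 := r_table S,
     14 := cell (r_limit S))"

lemma to_store_lookup [simp]:
  "to_store S 0 = r_inp S"
  "to_store S (Suc 0) = cell (r_ans S)"
  "to_store S 2 = cell (r_pos S)"
  "to_store S 3 = cell (r_budget S)"
  "to_store S 4 = cell (r_bound S)"
  "to_store S 5 = cell (r_num S)"
  "to_store S 6 = cell (r_target S)"
  "to_store S 7 = r_costs S"
  "to_store S 8 = r_weights S"
  "to_store S 9 = r_keys S"
  "to_store S 10 = cell (r_index S)"
  "to_store S 11 = cell (r_key S)"
  "to_store S 12 = cell (r_entry S)"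
  "to_store S 13 = r_table S"
  "to_store S 14 = cell (r_limit S)"
  by (simp_all add: to_store_def)

text \<open>Together with \<open>to_store_lookup\<close> these rules keep stores in the form
  \<open>to_store S\<close> during symbolic execution. Array 0 has no rule as the input is never
  overwritten; array 1 appears as \<open>Suc 0\<close> because the simplifier rewrites it
  so.\<close>

lemma to_store_update [simp]:
  "(to_store S)(Suc 0 := cell x) = to_store (S\<lparr>r_ans := x\<rparr>)"
  "(to_store S)(2 := cell x) = to_store (S\<lparr>r_pos := x\<rparr>)"
  "(to_store S)(3 := cell x) = to_store (S\<lparr>r_budget := x\<rparr>)"
  "(to_store S)(4 := cell x) = to_store (S\<lparr>r_bound := x\<rparr>)"
  "(to_store S)(5 := cell x) = to_store (S\<lparr>r_num := x\<rparr>)"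
  "(to_store S)(6 := cell x) = to_store (S\<lparr>r_target := x\<rparr>)"
  "(to_store S)(7 := f) = to_store (S\<lparr>r_costs := f\<rparr>)"
  "(to_store S)(8 := f) = to_store (S\<lparr>r_weights := f\<rparr>)"
  "(to_store S)(9 := f) = to_store (S\<lparr>r_keys := f\<rparr>)"
  "(to_store S)(10 := cell x) = to_store (S\<lparr>r_index := x\<rparr>)"
  "(to_store S)(11 := cell x) = to_store (S\<lparr>r_key := x\<rparr>)"
  "(to_store S)(12 := cell x) = to_store (S\<lparr>r_entry := x\<rparr>)"
  "(to_store S)(13 := f) = to_store (S\<lparr>r_table := f\<rparr>)"
  "(to_store S)(14 := cell x) = to_store (S\<lparr>r_limit := x\<rparr>)"
  by (simp_all add: to_store_def fun_eq_iff)

lemmas to_store_eqI = arg_cong[where f = to_store, OF ram.equality]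

definition store_0 :: "symbol list \<Rightarrow> ram" where
  "store_0 w = \<lparr>r_inp = codes w, r_ans = 0, r_pos = 0, r_budget = 0, r_bound = 0, r_num = 0,
     r_target = 0, r_costs = \<lambda>_. 0, r_weights = \<lambda>_. 0, r_keys = \<lambda>_. 0, r_index = 0, r_key = 0,
     r_entry = 0, r_table = \<lambda>_. 0, r_limit = 0\<rparr>"

lemma initial_store_eq: "initial_store w = to_store (store_0 w)"
  by (auto simp: initial_store_def store_0_def to_store_def codes_def cell_def fun_eq_iff)

section \<open>The code of the decision program\<close>

text \<open>A project entry starts with its flag, so a \<open>Sep\<close> in that place ends the
  list. Array 5 counts the projects and is the index of the current one.\<close>

definition parse_projects :: prog where
  "parse_projects =
     While (Minus (Const 3) symbol_at_head)
       (Seq (Seq (Cond (Minus symbol_at_head (Const 1)) (Assign 6 (Const 0) (Var 5)) Skip)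
              (increment 2))
       (Seq (read_number False 7 (Var 5))
       (Seq (read_number True 8 (Var 5))
         (increment 5))))"

text \<open>Cells beyond the word contain 0, which ends the outer loop; the row length is known from
  array 5. Subtraction from 2 maps \<open>Zero\<close> to 1 and \<open>One\<close> to 0, so array 9
  counts disapprovals.\<close>

definition parse_voters :: prog where
  "parse_voters =
     While symbol_at_head
       (Seq (While (Minus (Var 5) (Var 10))
              (Seq (Assign 9 (Var 10) (Plus (Cell 9 (Var 10)) (Minus (Const 2) symbol_at_head)))
              (Seq (increment 2) (increment 10))))
       (Seq (Assign 10 (Const 0) (Const 0)) (increment 2)))"

text \<open>The table is updated in place. The entries are visited in decreasing order because entry \<open>c\<close>
  depends on the old value of a smaller one. Addition of a truncated difference computes the
  maximum.\<close>

definition update_entry :: prog where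
  "update_entry =
     Seq (decrement 12)
     (Seq (Cond (Minus (Plus (Var 12) (Cell 7 (Var 10))) (Var 3))
            Skip
            (Assign 13 (Var 12) (Minus (Cell 13 (Var 12)) (Cell 8 (Var 10)))))
       (Cond (Plus (Minus (Cell 7 (Var 10)) (Var 12)) (Minus (Var 12) (Var 3)))
         Skip
         (Assign 13 (Var 12) (Plus (Cell 13 (Var 12))
            (Minus (Cell 13 (Minus (Var 12) (Cell 7 (Var 10)))) (Cell 13 (Var 12)))))))"

text \<open>After parsing, the reading position in array 2 equals the input length and serves as the
  largest index of the table.\<close>

definition update_table :: prog where
  "update_table =
     Seq (Assign 12 (Const 0) (Plus (Var 2) (Const 1))) (While (Var 12) update_entry)"

text \<open>The sum of the two truncated differences vanishes iff the key of the project is the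
  current key in array 11.\<close>

definition process_bucket :: prog where
  "process_bucket =
     While (Minus (Var 14) (Var 10))
       (Seq (Cond (Plus (Minus (Cell 9 (Var 10)) (Var 11)) (Minus (Var 11) (Cell 9 (Var 10))))
              Skip update_table)
         (increment 10))"

text \<open>Array 14 is the end of the scan: all projects for keys smaller than that of the target,
  only those before the target for its own key.\<close>

definition process_buckets :: prog where
  "process_buckets =
     While (Minus (Plus (Cell 9 (Var 6)) (Const 1)) (Var 11))
       (Seq (Cond (Minus (Cell 9 (Var 6)) (Var 11))
              (Assign 14 (Const 0) (Var 5)) (Assign 14 (Const 0) (Var 6)))
       (Seq process_bucket
         (Seq (Assign 10 (Const 0) (Const 0)) (Seq (Assign 14 (Const 0) (Const 0))
           (increment 11)))))"

definition search_table :: "bool \<Rightarrow> prog" where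
  "search_table destr =
     Seq (Assign 12 (Const 0) (Plus (Var 2) (Const 1)))
     (While (Var 12)
       (Seq (decrement 12)
         (Cond (Cell 13 (Var 12))
           (Cond (Minus (Plus (Var 12) (Cell 7 (Var 6))) (Var 3))
             (if destr then Assign 1 (Const 0) (Const 1) else Skip)
             (if destr then Skip else Assign 1 (Const 0) (Const 1)))
           Skip)))"

text \<open>The assignment to array 13 creates the initial table: entry 0 is the bound plus one, all
  others are still 0.\<close>

definition control_program :: "bool \<Rightarrow> prog" where
  "control_program destr =
     Seq (read_number True 3 (Const 0))
     (Seq (read_number True 4 (Const 0))
     (Seq parse_projects
     (Seq (increment 2)
     (Seq parse_voters
     (Seq (Assign 13 (Const 0) (Plus (Var 4) (Const 1)))
     (Seq process_buckets
       (search_table destr)))))))"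

section \<open>Parsing of projects and voters\<close>

lemma runs_parse_projects:
  fixes I :: "('p, 'v) control_input"
  defines "E \<equiv> election I"
  defines "ps \<equiv> projects E"
  assumes inp: "r_inp S = codes w"
    and w: "w = us @ concat (map (encode_project I) ps) @ Sep # vs"
    and S: "r_pos S = length us" "r_num S = 0" "r_target S = 0" "r_costs S = (\<lambda>_. 0)"
      "r_weights S = (\<lambda>_. 0)"
    and ps: "distinct ps" "t < length ps" "ps ! t = target I"
  shows "runs parse_projects (to_store S) (length w * (length w * 6 + 9) + 1)
    (to_store (S\<lparr>r_pos := length us + length (concat (map (encode_project I) ps)),
      r_num := length ps, r_target := t,
      r_costs := segment (length ps) (\<lambda>j. cost E (ps ! j)),
      r_weights := segment (length ps) (\<lambda>j. weight I (ps ! j))\<rparr>))"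
proof -
  let ?pre = "\<lambda>i. us @ concat (map (encode_project I) (take i ps))"
  \<comment> \<open>The state after \<open>i\<close> entries; the target index keeps its initial 0
    until entry \<open>t\<close> has been read.\<close>
  define f where "f i = S\<lparr>r_pos := length (?pre i),
      r_num := i, r_target := (if t < i then t else 0),
      r_costs := segment i (\<lambda>j. cost E (ps ! j)),
      r_weights := segment i (\<lambda>j. weight I (ps ! j))\<rparr>" for i
  let ?flag = "Seq (Cond (Minus symbol_at_head (Const 1)) (Assign 6 (Const 0) (Var 5)) Skip)
      (increment 2)"
  have split: "w = ?pre i @ bit_symbol (ps ! i = target I) #
      replicate (cost E (ps ! i)) One @ Sep # binary_digits (weight I (ps ! i)) @ Sep #
      concat (map (encode_project I) (drop (Suc i) ps)) @ Sep # vs" if "i < length ps" for i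
  proof -
    have "concat (map (encode_project I) ps) = concat (map (encode_project I) (take i ps)) @
        encode_project I (ps ! i) @ concat (map (encode_project I) (drop (Suc i) ps))"
      using arg_cong[OF id_take_nth_drop[OF that], of "\<lambda>xs. concat (map (encode_project I) xs)"]
      by (simp only: map_append list.map concat_append concat.simps)
    then show ?thesis
      by (simp add: w encode_project_def encode_unary_def encode_binary_def E_def)
  qed
  show ?thesis
    unfolding parse_projects_def
  proof (rule runs_WhileI[where f = "\<lambda>i. to_store (f i)" and n = "length ps"
        and k = "length w * 6 + 8"])
    show "to_store (f 0) = to_store S"
      by (rule to_store_eqI) (simp_all add: f_def S)
    show "to_store (f (length ps)) = to_store (S\<lparr>
      r_pos := length us + length (concat (map (encode_project I) ps)),
      r_num := length ps, r_target := t,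
      r_costs := segment (length ps) (\<lambda>j. cost E (ps ! j)),
      r_weights := segment (length ps) (\<lambda>j. weight I (ps ! j))\<rparr>)"
      using ps(2) by (intro to_store_eqI) (simp_all add: f_def)
    show "eval_expr (Minus (Const 3) symbol_at_head) (to_store (f (length ps))) = 0"
      using codes_append[of "?pre (length ps)" "Sep # vs" 0]
      by (simp add: f_def inp w codes_def)
    have "length ps \<le> length (concat (map (encode_project I) ps))"
      by (induction ps) (simp_all add: encode_project_def)
    then show "length ps \<le> length w" by (simp add: w)
    fix i assume i: "i < length ps"
    have head: "codes w (length (?pre i)) = symbol_code (bit_symbol (ps ! i = target I))"
      by (subst split[OF i]) (simp add: codes_def nth_append)
    then show "eval_expr (Minus (Const 3) symbol_at_head) (to_store (f i)) \<noteq> 0"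
      by (simp add: f_def inp bit_symbol_def)
    define S1 where "S1 = (f i)\<lparr>r_pos := length (?pre i) + 1,
      r_target := (if t < Suc i then t else 0)\<rparr>"
    define S2 where "S2 = S1\<lparr>r_pos := length (?pre i) + 1 + cost E (ps ! i) + 1,
      r_costs := segment (Suc i) (\<lambda>j. cost E (ps ! j))\<rparr>"
    define S3 where "S3 = S2\<lparr>r_pos := length (?pre i) + 1 + cost E (ps ! i) + 1 +
        length (binary_digits (weight I (ps ! i))) + 1,
      r_weights := segment (Suc i) (\<lambda>j. weight I (ps ! j))\<rparr>"
    have target_iff: "ps ! i = target I \<longleftrightarrow> i = t"
      using ps i by (metis nth_eq_iff_index_eq)
    have "straight ?flag (to_store (f i)) = to_store S1"
      using head target_iff
      by (auto simp: f_def S1_def inp bit_symbol_def intro!: to_store_eqI)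
    then have run1: "runs ?flag (to_store (f i)) 3 (to_store S1)"
      by (rule runs_straightI) simp_all
    have run2: "runs (read_number False 7 (Var 5)) (to_store S1) (length w * 3 + 2) (to_store S2)"
    proof (rule runs_read_number[where w = w and v = i and ys = "replicate (cost E (ps ! i)) One"
          and us = "?pre i @ [bit_symbol (ps ! i = target I)]"])
      show "w = (?pre i @ [bit_symbol (ps ! i = target I)]) @ replicate (cost E (ps ! i)) One @
          Sep # binary_digits (weight I (ps ! i)) @ Sep #
          concat (map (encode_project I) (drop (Suc i) ps)) @ Sep # vs"
        by (subst split[OF i]) simp
    qed (auto simp: S1_def S2_def f_def inp digits_value_replicate less_Suc_eq
        intro!: to_store_eqI)
    have run3: "runs (read_number True 8 (Var 5)) (to_store S2) (length w * 3 + 2) (to_store S3)"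
    proof (rule runs_read_number[where w = w and v = i and ys = "binary_digits (weight I (ps ! i))"
          and us = "?pre i @ [bit_symbol (ps ! i = target I)] @
            replicate (cost E (ps ! i)) One @ [Sep]"])
      show "w = (?pre i @ [bit_symbol (ps ! i = target I)] @
            replicate (cost E (ps ! i)) One @ [Sep]) @ binary_digits (weight I (ps ! i)) @ Sep #
          concat (map (encode_project I) (drop (Suc i) ps)) @ Sep # vs"
        by (subst split[OF i]) simp
    qed (auto simp: S1_def S2_def S3_def f_def inp digits_value_binary_digits less_Suc_eq
        Sep_notin_binary_digits intro!: to_store_eqI)
    have "straight (increment 5) (to_store S3) = to_store (f (Suc i))"
      using i by (auto simp: S1_def S2_def S3_def f_def take_Suc_conv_app_nth encode_project_def
          encode_unary_def encode_binary_def E_def intro!: to_store_eqI)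
    then have run4: "runs (increment 5) (to_store S3) 1 (to_store (f (Suc i)))"
      by (rule runs_straightI) simp_all
    show "runs (Seq ?flag (Seq (read_number False 7 (Var 5)) (Seq (read_number True 8 (Var 5))
        (increment 5)))) (to_store (f i)) (length w * 6 + 8) (to_store (f (Suc i)))"
      by (rule runs_mono[OF runs_Seq[OF run1 runs_Seq[OF run2 runs_Seq[OF run3 run4]]]]) simp
  qed simp
qed

lemma length_concat_equal_length:
  "(\<And>xs. xs \<in> set xss \<Longrightarrow> length xs = k) \<Longrightarrow> length (concat xss) = length xss * k"
  by (induction xss) simp_all

text \<open>Row-major addressing, needed for the approval matrix.\<close>

lemma nth_concat_equal_length:
  assumes "\<And>xs. xs \<in> set xss \<Longrightarrow> length xs = k" "i < length xss" "l < k"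
  shows "concat xss ! (i * k + l) = xss ! i ! l"
  using assms
proof (induction xss arbitrary: i)
  case (Cons xs xss)
  then show ?case by (cases i) (simp_all add: nth_append add.assoc)
qed simp

lemma runs_parse_voters:
  fixes I :: "('p, 'v) control_input"
  defines "E \<equiv> election I"
  defines "ps \<equiv> projects E"
  assumes inp: "r_inp S = codes w" and w: "w = us @ concat (map (encode_voter I) vs)"
    and S: "r_pos S = length us" "r_num S = length ps" "r_keys S = (\<lambda>_. 0)" "r_index S = 0"
    and ps: "length ps \<le> length w"
  shows "runs parse_voters (to_store S) (length w * (length w * 4 + 4) + 1)
    (to_store (S\<lparr>r_pos := length w,
      r_keys := segment (length ps) (\<lambda>j. length (filter (\<lambda>v. ps ! j \<notin> approves E v) vs))\<rparr>))"
proof -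
  let ?m = "length ps"
  define K where "K i j = length (filter (\<lambda>v. ps ! j \<notin> approves E v) (take i vs))" for i j
  define f where "f i = S\<lparr>r_pos := length us + i * (?m + 1), r_keys := segment ?m (K i)\<rparr>" for i
  have rows: "length xs = ?m + 1" if "xs \<in> set (map (encode_voter I) vs)" for xs
    using that by (auto simp: encode_voter_def ps_def E_def)
  have length_w: "length w = length us + length vs * (?m + 1)"
    using length_concat_equal_length[of "map (encode_voter I) vs", OF rows] by (simp add: w)
  have head: "codes w (length us + (i * (?m + 1) + l)) = symbol_code (encode_voter I (vs ! i) ! l)"
    if "i < length vs" "l < ?m + 1" for i l
  proof -
    have "i * (?m + 1) + l < length vs * (?m + 1)"
      using that mult_le_mono1[of "Suc i" "length vs" "?m + 1"] by simp
    then have "i * (?m + 1) + l < length (concat (map (encode_voter I) vs))"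
      using length_concat_equal_length[of "map (encode_voter I) vs", OF rows] by simp
    moreover have "concat (map (encode_voter I) vs) ! (i * (?m + 1) + l) = encode_voter I (vs ! i) ! l"
      using nth_concat_equal_length[of "map (encode_voter I) vs" "?m + 1" i l, OF rows] that
      by simp
    ultimately show ?thesis
      unfolding w codes_append by (simp add: codes_def)
  qed
  let ?inner = "Seq (Assign 9 (Var 10) (Plus (Cell 9 (Var 10)) (Minus (Const 2) symbol_at_head)))
    (Seq (increment 2) (increment 10))"
  show ?thesis
    unfolding parse_voters_def
  proof (rule runs_WhileI[where f = "\<lambda>i. to_store (f i)" and n = "length vs"
        and k = "length w * 4 + 3" and N = "length w"])
    show "to_store (f 0) = to_store S"
      by (rule to_store_eqI) (simp_all add: f_def S K_def segment_def fun_eq_iff)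
    show "to_store (f (length vs)) = to_store (S\<lparr>r_pos := length w,
        r_keys := segment ?m (\<lambda>j. length (filter (\<lambda>v. ps ! j \<notin> approves E v) vs))\<rparr>)"
      by (rule to_store_eqI) (simp_all add: f_def K_def length_w segment_def fun_eq_iff)
    show "eval_expr symbol_at_head (to_store (f (length vs))) = 0"
      by (simp add: f_def inp codes_def length_w)
    show "length vs \<le> length w" by (simp add: length_w)
    fix i assume i: "i < length vs"
    show "eval_expr symbol_at_head (to_store (f i)) \<noteq> 0"
      using head[OF i, of 0] by (cases "encode_voter I (vs ! i) ! 0") (simp_all add: f_def inp)
    \<comment> \<open>Inside row \<open>i\<close>, the columns before \<open>l\<close> already count
      voter \<open>i\<close>, the others do not yet.\<close>
    define g where "g l = S\<lparr>r_pos := length us + (i * (?m + 1) + l), r_index := l,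
      r_keys := segment ?m (\<lambda>j. K (if j < l then Suc i else i) j)\<rparr>" for l
    have step: "straight ?inner (to_store (g l)) = to_store (g (Suc l))" if l: "l < ?m" for l
    proof -
      have "encode_voter I (vs ! i) ! l = bit_symbol (ps ! l \<in> approves E (vs ! i))"
        using l by (simp add: encode_voter_def nth_append ps_def E_def)
      then have "K (Suc i) l = K i l + (2 - codes w (length us + (i * (?m + 1) + l)))"
        using head[OF i, of l] l i
        by (simp add: K_def take_Suc_conv_app_nth bit_symbol_def)
      then have "(segment ?m (\<lambda>j. K (if j < l then Suc i else i) j))
          (l := K i l + (2 - codes w (length us + (i * (?m + 1) + l)))) =
          segment ?m (\<lambda>j. K (if j < Suc l then Suc i else i) j)"
        using l by (auto simp: segment_def fun_eq_iff less_Suc_eq)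
      then show ?thesis
        using l by (auto simp: g_def inp intro!: to_store_eqI)
    qed
    have "runs (While (Minus (Var 5) (Var 10)) ?inner) (to_store (f i)) (length w * 4 + 1)
        (to_store (g ?m))"
    proof (rule runs_WhileI[where f = "\<lambda>l. to_store (g l)" and n = ?m and k = 3 and N = "length w"])
      show "to_store (g 0) = to_store (f i)"
        by (rule to_store_eqI) (simp_all add: f_def g_def S)
      show "runs ?inner (to_store (g l)) 3 (to_store (g (Suc l)))" if "l < ?m" for l
        by (rule runs_straightI[OF step[OF that]]) simp_all
    qed (simp_all add: g_def S ps)
    moreover have "straight (Seq (Assign 10 (Const 0) (Const 0)) (increment 2)) (to_store (g ?m)) =
        to_store (f (Suc i))"
      by (auto simp: f_def g_def S segment_def intro!: to_store_eqI)
    then have "runs (Seq (Assign 10 (Const 0) (Const 0)) (increment 2)) (to_store (g ?m)) 2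
        (to_store (f (Suc i)))"
      by (rule runs_straightI) simp_all
    ultimately have "runs (Seq (While (Minus (Var 5) (Var 10)) ?inner)
        (Seq (Assign 10 (Const 0) (Const 0)) (increment 2)))
        (to_store (f i)) (length w * 4 + 1 + 2) (to_store (f (Suc i)))"
      by (rule runs_Seq)
    then show "runs (Seq (While (Minus (Var 5) (Var 10)) ?inner)
        (Seq (Assign 10 (Const 0) (Const 0)) (increment 2)))
        (to_store (f i)) (length w * 4 + 3) (to_store (f (Suc i)))"
      by (rule runs_mono) simp
  qed simp
qed

section \<open>Correctness of the table updates\<close>

text \<open>By \<open>1 \<le> k\<close> the entry \<open>c - k\<close> read for \<open>c\<close>
  lies strictly below \<open>c\<close>, so the downward pass has not overwritten it yet.\<close>

lemma runs_update_table:
  fixes S :: ram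
  defines "k \<equiv> r_costs S (r_index S)"
  assumes k: "1 \<le> k"
  shows "runs update_table (to_store S) ((r_pos S + 1) * 6 + 2)
    (to_store (S\<lparr>r_entry := 0,
      r_table := \<lambda>c. if c \<le> r_pos S
        then dp_step (r_budget S) k (r_weights S (r_index S)) (r_table S) c
        else r_table S c\<rparr>))"
proof -
  let ?N = "r_pos S"
  let ?G = "dp_step (r_budget S) k (r_weights S (r_index S)) (r_table S)"
  define g where "g i = S\<lparr>r_entry := ?N + 1 - i,
    r_table := \<lambda>c. if ?N + 1 - i \<le> c \<and> c \<le> ?N then ?G c else r_table S c\<rparr>" for i
  have step: "straight update_entry (to_store (g i)) = to_store (g (Suc i))" if "i < ?N + 1" for i
  proof -
    \<comment> \<open>Iteration \<open>i\<close> decrements first and thus handles entry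
      \<open>?N - i\<close>.\<close>
    define c where "c = ?N - i"
    have c: "?N + 1 - i = Suc c" "?N + 1 - Suc i = c" "c \<le> ?N" using that by (auto simp: c_def)
    have g: "g i = S\<lparr>r_entry := Suc c,
        r_table := \<lambda>x. if c < x \<and> x \<le> ?N then ?G x else r_table S x\<rparr>"
      unfolding g_def c(1) Suc_le_eq ..
    let ?new = "\<lambda>x. if c \<le> x \<and> x \<le> ?N then ?G x else r_table S x"
    have upd: "(\<lambda>x. if c < x \<and> x \<le> ?N then ?G x else r_table S x)(c := ?G c) = ?new"
      using c(3) by (auto simp: fun_eq_iff)
    have g': "g (Suc i) = S\<lparr>r_entry := c, r_table := ?new\<rparr>"
      unfolding g_def c(2) ..
    have G: "?G c = max (if c + k \<le> r_budget S then r_table S c - r_weights S (r_index S)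
        else r_table S c) (if k \<le> c \<and> c \<le> r_budget S then r_table S (c - k) else 0)"
      by (simp add: dp_step_def)
    show ?thesis
      unfolding g g' upd[symmetric] G update_entry_def
      using k
      by (cases "c + k \<le> r_budget S"; cases "k \<le> c \<and> c \<le> r_budget S")
        (auto simp: k_def[symmetric] max_def intro!: to_store_eqI)
  qed
  have "runs (While (Var 12) update_entry) (to_store (g 0)) ((?N + 1) * 6 + 1) (to_store (g (?N + 1)))"
  proof (rule runs_WhileI[where f = "\<lambda>i. to_store (g i)" and n = "?N + 1" and k = 5
        and N = "?N + 1", OF refl refl])
    show "runs update_entry (to_store (g i)) 5 (to_store (g (Suc i)))" if "i < ?N + 1" for i
      by (rule runs_straightI[OF step[OF that]]) (simp_all add: update_entry_def)
  qed (simp_all add: g_def)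
  moreover have "straight (Assign 12 (Const 0) (Plus (Var 2) (Const 1))) (to_store S) = to_store (g 0)"
    by (auto simp: g_def intro!: to_store_eqI)
  then have "runs (Assign 12 (Const 0) (Plus (Var 2) (Const 1))) (to_store S) 1 (to_store (g 0))"
    by (rule runs_straightI) simp_all
  ultimately have "runs update_table (to_store S) (1 + ((?N + 1) * 6 + 1)) (to_store (g (?N + 1)))"
    unfolding update_table_def by (intro runs_Seq)
  then show ?thesis by (simp add: g_def)
qed

text \<open>Beyond \<open>N\<close> both tables are 0, so an update confined to the indices up to
  \<open>N\<close> yields the full table.\<close>

lemma dp_table_update:
  assumes "sum_list (map (cost E) (qs @ [q])) \<le> N"
  shows "(\<lambda>c. if c \<le> N then dp_step (budget E) (cost E q) (w q) (dp_table E w r qs) c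
    else dp_table E w r qs c) = dp_table E w r (qs @ [q])"
proof
  fix c
  show "(if c \<le> N then dp_step (budget E) (cost E q) (w q) (dp_table E w r qs) c
      else dp_table E w r qs c) = dp_table E w r (qs @ [q]) c"
    using assms dp_table_eq_0[of E qs c w r] dp_table_eq_0[of E "qs @ [q]" c w r]
    by (auto simp flip: dp_table_snoc)
qed

text \<open>The invariant is that the array holds the table of \<open>qs\<close> followed by the
  matching projects scanned so far. By \<open>sum\<close>, all attainable costs stay within the
  updated range.\<close>

lemma runs_process_bucket:
  fixes key :: "'p \<Rightarrow> nat"
  assumes S: "r_index S = 0" "r_entry S = 0" "r_limit S \<le> length ps" "r_budget S = budget E"
      "r_table S = dp_table E w r qs"
    and arrays: "\<And>j. j < length ps \<Longrightarrow> r_costs S j = cost E (ps ! j)"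
      "\<And>j. j < length ps \<Longrightarrow> r_weights S j = w (ps ! j)"
      "\<And>j. j < length ps \<Longrightarrow> r_keys S j = key (ps ! j)"
    and cost_pos: "\<And>q. q \<in> set ps \<Longrightarrow> 1 \<le> cost E q"
    and N: "length ps \<le> N" "r_pos S = N"
    and sum: "sum_list (map (cost E)
      (qs @ filter (\<lambda>q. key q = r_key S) (take (r_limit S) ps))) \<le> N"
  shows "runs process_bucket (to_store S) (N * ((N + 1) * 6 + 5) + 1)
    (to_store (S\<lparr>r_index := r_limit S, r_table := dp_table E w r
      (qs @ filter (\<lambda>q. key q = r_key S) (take (r_limit S) ps))\<rparr>))"
proof -
  let ?L = "\<lambda>l. qs @ filter (\<lambda>q. key q = r_key S) (take l ps)"
  define g where "g l = S\<lparr>r_index := l, r_table := dp_table E w r (?L l)\<rparr>" for l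
  let ?b = "Plus (Minus (Cell 9 (Var 10)) (Var 11)) (Minus (Var 11) (Cell 9 (Var 10)))"
  show ?thesis
    unfolding process_bucket_def
  proof (rule runs_WhileI[where f = "\<lambda>l. to_store (g l)" and n = "r_limit S"
        and k = "(N + 1) * 6 + 4" and N = N])
    show "to_store (g 0) = to_store S"
      by (rule to_store_eqI) (simp_all add: g_def S)
    fix l assume l: "l < r_limit S"
    then have lps: "l < length ps" using S(3) by simp
    have "sum_list (map (cost E) (?L (Suc l))) \<le> sum_list (map (cost E) (?L (r_limit S)))"
    proof -
      have "take (r_limit S) ps = take (Suc l) ps @ drop (Suc l) (take (r_limit S) ps)"
        using l by (metis Suc_leI append_take_drop_id min_def take_take)
      then show ?thesis by (metis (no_types, lifting) append.assoc filter_append le_add1 map_append sum_list_append)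
    qed
    then have sum_l: "sum_list (map (cost E) (?L (Suc l))) \<le> N" using sum by linarith
    \<comment> \<open>Both branches leave \<open>r_entry\<close> at 0 and therefore end in the same
      state.\<close>
    let ?S = "(g l)\<lparr>r_table := dp_table E w r (?L (Suc l))\<rparr>"
    have "runs (if eval_expr ?b (to_store (g l)) \<noteq> 0 then Skip else update_table) (to_store (g l))
        ((N + 1) * 6 + 2) (to_store ?S)"
    proof (cases "key (ps ! l) = r_key S")
      case True
      then have L: "?L (Suc l) = ?L l @ [ps ! l]"
        using lps by (simp add: take_Suc_conv_app_nth)
      have "runs update_table (to_store (g l)) ((N + 1) * 6 + 2)
          (to_store ((g l)\<lparr>r_entry := 0,
            r_table := \<lambda>c. if c \<le> N
              then dp_step (budget E) (cost E (ps ! l)) (w (ps ! l)) (dp_table E w r (?L l)) c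
              else dp_table E w r (?L l) c\<rparr>))"
      proof -
        have "r_pos (g l) = N" "r_index (g l) = l" "r_budget (g l) = budget E"
          "r_costs (g l) l = cost E (ps ! l)" "r_weights (g l) l = w (ps ! l)"
          "r_table (g l) = dp_table E w r (?L l)"
          using lps by (simp_all add: g_def arrays N S)
        from runs_update_table[of "g l", unfolded this] show ?thesis
          using cost_pos[of "ps ! l"] lps by simp
      qed
      also have "(g l)\<lparr>r_entry := 0,
            r_table := \<lambda>c. if c \<le> N
              then dp_step (budget E) (cost E (ps ! l)) (w (ps ! l)) (dp_table E w r (?L l)) c
              else dp_table E w r (?L l) c\<rparr> = ?S"
        using sum_l unfolding L
        by (subst dp_table_update) (simp_all add: g_def S(2))
      finally show ?thesis using True lps by (simp add: g_def arrays)
    next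
      case False
      then have "?S = g l" using lps by (simp add: g_def take_Suc_conv_app_nth)
      then show ?thesis
        using False lps runs_mono[OF runs_Skip, of "(N + 1) * 6 + 2" "to_store (g l)"]
        by (auto simp: g_def arrays)
    qed
    from runs_Cond[OF this]
    have 1: "runs (Cond ?b Skip update_table) (to_store (g l)) (Suc ((N + 1) * 6 + 2)) (to_store ?S)" .
    have "straight (increment 10) (to_store ?S) = to_store (g (Suc l))"
      by (auto simp: g_def intro!: to_store_eqI)
    then have 2: "runs (increment 10) (to_store ?S) 1 (to_store (g (Suc l)))"
      by (rule runs_straightI) simp_all
    show "runs (Seq (Cond ?b Skip update_table) (increment 10)) (to_store (g l)) ((N + 1) * 6 + 4)
        (to_store (g (Suc l)))"
      by (rule runs_mono[OF runs_Seq[OF 1 2]]) simp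
  qed (use S(3) N in \<open>simp_all add: g_def\<close>)
qed

section \<open>Buckets up to the target\<close>

text \<open>Mirrors the scan limit of the program: the bucket of the target is cut at its position
  \<open>t\<close>.\<close>

definition bucket :: "('p \<Rightarrow> nat) \<Rightarrow> 'p list \<Rightarrow> nat \<Rightarrow> nat \<Rightarrow> 'p list" where
  "bucket key ps t d =
     filter (\<lambda>q. key q = d) (take (if d < key (ps ! t) then length ps else t) ps)"

definition buckets :: "('p \<Rightarrow> nat) \<Rightarrow> 'p list \<Rightarrow> nat \<Rightarrow> nat \<Rightarrow> 'p list" where
  "buckets key ps t d = concat (map (bucket key ps t) [0..<d])"

lemma set_bucket: "set (bucket key ps t d) \<subseteq> {q \<in> set ps. key q = d}"
  by (auto simp: bucket_def dest: in_set_takeD)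

lemma set_buckets: "set (buckets key ps t d) \<subseteq> {q \<in> set ps. key q < d}"
  using set_bucket[of key ps t] by (fastforce simp: buckets_def)

lemma buckets_Suc: "buckets key ps t (Suc d) = buckets key ps t d @ bucket key ps t d"
  by (simp add: buckets_def)

lemma distinct_buckets: "distinct ps \<Longrightarrow> distinct (buckets key ps t d)"
proof (induction d)
  case (Suc d)
  have "distinct (bucket key ps t d)" using Suc.prems by (simp add: bucket_def)
  moreover have "set (buckets key ps t d) \<inter> set (bucket key ps t d) = {}"
    using set_buckets[of key ps t d] set_bucket[of key ps t d] by fastforce
  ultimately show ?case using Suc by (simp add: buckets_Suc)
qed (simp add: buckets_def)

text \<open>The buckets list elements of \<open>ps\<close> without repetition. Applied to the costs,
  this keeps every table within the input length.\<close>

lemma sum_list_buckets_le: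
  fixes f :: "'p \<Rightarrow> nat"
  assumes "distinct ps"
  shows "sum_list (map f (buckets key ps t d)) \<le> sum_list (map f ps)"
proof -
  have "sum f (set (buckets key ps t d)) \<le> sum f (set ps)"
    using set_buckets[of key ps t d] by (intro sum_mono2) auto
  then show ?thesis
    using assms distinct_buckets[OF assms, of key t d] by (simp add: sum_list_distinct_conv_sum_set)
qed

text \<open>Identifies the projects handled by the program, in their order, with those sorted ahead
  of the target.\<close>

lemma sort_key_prefix_buckets:
  assumes "t < length ps"
  shows "\<exists>ys. sort_key key ps = buckets key ps t (Suc (key (ps ! t))) @ ps ! t # ys"
proof -
  have low: "map (bucket key ps t) [0..<key (ps ! t)] =
      map (\<lambda>d. filter (\<lambda>q. key q = d) ps) [0..<key (ps ! t)]"
    by (simp add: bucket_def)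
  have top: "bucket key ps t (key (ps ! t)) = filter (\<lambda>q. key q = key (ps ! t)) (take t ps)"
    by (simp add: bucket_def)
  show ?thesis
    unfolding buckets_Suc top unfolding buckets_def low append_assoc
    by (rule sort_key_buckets[OF assms])
qed

lemma runs_process_buckets:
  fixes key :: "'p \<Rightarrow> nat"
  assumes S: "r_index S = 0" "r_entry S = 0" "r_limit S = 0" "r_key S = 0" "r_num S = length ps"
      "r_target S = t" "r_budget S = budget E" "r_table S = dp_table E w r []"
    and arrays: "\<And>j. j < length ps \<Longrightarrow> r_costs S j = cost E (ps ! j)"
      "\<And>j. j < length ps \<Longrightarrow> r_weights S j = w (ps ! j)"
      "\<And>j. j < length ps \<Longrightarrow> r_keys S j = key (ps ! j)"
    and cost_pos: "\<And>q. q \<in> set ps \<Longrightarrow> 1 \<le> cost E q"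
    and ps: "distinct ps" "t < length ps"
    and N: "length ps \<le> N" "r_pos S = N" "sum_list (map (cost E) ps) \<le> N" "key (ps ! t) \<le> N"
  shows "runs process_buckets (to_store S) ((N + 1) * (N * ((N + 1) * 6 + 5) + 7) + 1)
    (to_store (S\<lparr>r_key := Suc (key (ps ! t)),
      r_table := dp_table E w r (buckets key ps t (Suc (key (ps ! t))))\<rparr>))"
proof -
  let ?kt = "key (ps ! t)"
  let ?lim = "\<lambda>d. if d < ?kt then length ps else t"
  define f where "f d = S\<lparr>r_key := d, r_table := dp_table E w r (buckets key ps t d)\<rparr>" for d
  let ?set_limit = "Cond (Minus (Cell 9 (Var 6)) (Var 11))
    (Assign 14 (Const 0) (Var 5)) (Assign 14 (Const 0) (Var 6))"
  let ?reset = "Seq (Assign 10 (Const 0) (Const 0)) (Seq (Assign 14 (Const 0) (Const 0)) (increment 11))"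
  show ?thesis
    unfolding process_buckets_def
  proof (rule runs_WhileI[where f = "\<lambda>d. to_store (f d)" and n = "Suc ?kt"
        and k = "N * ((N + 1) * 6 + 5) + 6" and N = "N + 1"])
    show "to_store (f 0) = to_store S"
      by (rule to_store_eqI) (simp_all add: f_def S buckets_def)
    fix d assume d: "d < Suc ?kt"
    show "eval_expr (Minus (Plus (Cell 9 (Var 6)) (Const 1)) (Var 11)) (to_store (f d)) \<noteq> 0"
      using d ps(2) by (simp add: f_def S arrays)
    define S1 where "S1 = (f d)\<lparr>r_limit := ?lim d\<rparr>"
    define S2 where "S2 = S1\<lparr>r_index := ?lim d,
      r_table := dp_table E w r (buckets key ps t (Suc d))\<rparr>"
    have "straight ?set_limit (to_store (f d)) = to_store S1"
      using ps(2) by (auto simp: f_def S1_def S arrays intro!: to_store_eqI)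
    then have 1: "runs ?set_limit (to_store (f d)) 2 (to_store S1)"
      by (rule runs_straightI) simp_all
    have "runs process_bucket (to_store S1) (N * ((N + 1) * 6 + 5) + 1)
        (to_store (S1\<lparr>r_index := r_limit S1, r_table := dp_table E w r
          (buckets key ps t d @ filter (\<lambda>q. key q = r_key S1) (take (r_limit S1) ps))\<rparr>))"
    proof (rule runs_process_bucket)
      have "sum_list (map (cost E) (buckets key ps t (Suc d))) \<le> N"
        using sum_list_buckets_le[OF ps(1), of "cost E" key t "Suc d"] N(3) by linarith
      then show "sum_list (map (cost E) (buckets key ps t d @
          filter (\<lambda>q. key q = r_key S1) (take (r_limit S1) ps))) \<le> N"
        by (simp add: buckets_Suc bucket_def S1_def f_def)
    qed (use ps(2) N cost_pos in \<open>simp_all add: S1_def f_def S arrays\<close>)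
    then have 2: "runs process_bucket (to_store S1) (N * ((N + 1) * 6 + 5) + 1) (to_store S2)"
      by (simp add: S2_def buckets_Suc bucket_def S1_def f_def)
    \<comment> \<open>Resetting the index and the limit restores the form \<open>f\<close> for the
      next key.\<close>
    have "straight ?reset (to_store S2) = to_store (f (Suc d))"
      by (auto simp: S2_def S1_def f_def S intro!: to_store_eqI)
    then have 3: "runs ?reset (to_store S2) 3 (to_store (f (Suc d)))"
      by (rule runs_straightI) simp_all
    show "runs (Seq ?set_limit (Seq process_bucket ?reset)) (to_store (f d))
        (N * ((N + 1) * 6 + 5) + 6) (to_store (f (Suc d)))"
      by (rule runs_mono[OF runs_Seq[OF 1 runs_Seq[OF 2 3]]]) simp
  qed (use ps(2) N in \<open>simp_all add: f_def S arrays\<close>)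
qed

section \<open>Search of the final table\<close>

lemma runs_search_table:
  assumes "r_ans S = 0"
  shows "runs (search_table destr) (to_store S) ((r_pos S + 1) * 5 + 2)
    (to_store (S\<lparr>r_entry := 0,
      r_ans := if \<exists>c \<le> r_pos S. r_table S c \<noteq> 0 \<and>
          (c + r_costs S (r_target S) \<le> r_budget S) \<noteq> destr then 1 else 0\<rparr>))"
proof -
  let ?N = "r_pos S"
  let ?P = "\<lambda>c. r_table S c \<noteq> 0 \<and> (c + r_costs S (r_target S) \<le> r_budget S) \<noteq> destr"
  define g where "g i = S\<lparr>r_entry := ?N + 1 - i,
    r_ans := if \<exists>c. ?N + 1 - i \<le> c \<and> c \<le> ?N \<and> ?P c then 1 else 0\<rparr>" for i
  let ?body = "Seq (decrement 12)
         (Cond (Cell 13 (Var 12))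
           (Cond (Minus (Plus (Var 12) (Cell 7 (Var 6))) (Var 3))
             (if destr then Assign 1 (Const 0) (Const 1) else Skip)
             (if destr then Skip else Assign 1 (Const 0) (Const 1)))
           Skip)"
  have step: "straight ?body (to_store (g i)) = to_store (g (Suc i))" if "i < ?N + 1" for i
  proof -
    define c where "c = ?N - i"
    have c: "?N + 1 - i = Suc c" "?N + 1 - Suc i = c" "c \<le> ?N" using that by (auto simp: c_def)
    \<comment> \<open>The range searched after this step consists of \<open>c\<close> and the range
      searched before.\<close>
    have "c \<le> x \<longleftrightarrow> x = c \<or> Suc c \<le> x" for x by auto
    then have "(\<exists>x. c \<le> x \<and> x \<le> ?N \<and> ?P x) \<longleftrightarrow> ?P c \<or> (\<exists>x. Suc c \<le> x \<and> x \<le> ?N \<and> ?P x)"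
      using c(3) by (simp only:) blast
    then have "g (Suc i) = S\<lparr>r_entry := c,
        r_ans := if ?P c \<or> (\<exists>x. Suc c \<le> x \<and> x \<le> ?N \<and> ?P x) then 1 else 0\<rparr>"
      unfolding g_def c(2) by simp
    moreover have "g i = S\<lparr>r_entry := Suc c,
        r_ans := if \<exists>x. Suc c \<le> x \<and> x \<le> ?N \<and> ?P x then 1 else 0\<rparr>"
      unfolding g_def c(1) ..
    ultimately show ?thesis
      by (cases destr) (auto intro!: to_store_eqI)
  qed
  have "runs (While (Var 12) ?body) (to_store (g 0)) ((?N + 1) * 5 + 1) (to_store (g (?N + 1)))"
  proof (rule runs_WhileI[where f = "\<lambda>i. to_store (g i)" and n = "?N + 1" and k = 4
        and N = "?N + 1", OF refl refl])
    show "runs ?body (to_store (g i)) 4 (to_store (g (Suc i)))" if "i < ?N + 1" for i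
      by (rule runs_straightI[OF step[OF that]]) simp_all
  qed (simp_all add: g_def)
  moreover have "straight (Assign 12 (Const 0) (Plus (Var 2) (Const 1))) (to_store S) = to_store (g 0)"
    by (auto simp: g_def assms intro!: to_store_eqI)
  then have "runs (Assign 12 (Const 0) (Plus (Var 2) (Const 1))) (to_store S) 1 (to_store (g 0))"
    by (rule runs_straightI) simp_all
  ultimately have "runs (search_table destr) (to_store S) (1 + ((?N + 1) * 5 + 1))
      (to_store (g (?N + 1)))"
    unfolding search_table_def by (intro runs_Seq)
  then show ?thesis by (simp add: g_def)
qed

section \<open>Correctness and polynomial running time of the whole program\<close>

text \<open>Stated over any commutative semiring, so that the same formula gives a number of steps
  and, at the indeterminate \<open>[:0, 1:]\<close>, a polynomial. Its nesting follows that of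
  \<open>Seq\<close> in \<open>control_program\<close>.\<close>

definition control_steps :: "'a :: comm_semiring_1 \<Rightarrow> 'a" where
  "control_steps N =
     (N * 3 + 2) + ((N * 3 + 2) + ((N * (N * 6 + 9) + 1) + (1 + ((N * (N * 4 + 4) + 1) +
       (1 + (((N + 1) * (N * ((N + 1) * 6 + 5) + 7) + 1) + ((N + 1) * 5 + 2)))))))"

lemma runs_control_program:
  fixes I :: "('p, 'v) control_input"
  assumes I: "pb_instance (election I)" "target I \<in> set (projects (election I))"
    and w: "w \<in> encodings I"
  shows "\<exists>s. runs (control_program destr) (initial_store w) (control_steps (length w)) s \<and>
    s 1 0 = (if \<exists>D \<in> deletion_sets I.
      (target I \<in> greedyAV (delete_projects D (election I))) \<noteq> destr then 1 else 0)"
proof -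
  define E where "E = election I"
  define ps where "ps = projects E"
  let ?N = "length w" and ?m = "length ps"
  let ?B = "encode_binary (budget E)" and ?R = "encode_binary (bound I)"
    and ?P = "concat (map (encode_project I) ps)"
  obtain vs where vs: "distinct vs" "set vs = voters E"
    and w_eq: "w = ?B @ ?R @ ?P @ [Sep] @ concat (map (encode_voter I) vs)"
    using w by (auto simp: encodings_def E_def ps_def)
  have cost_pos: "1 \<le> cost E q" if "q \<in> set ps" for q
    using I(1) that by (auto simp: pb_instance_def E_def ps_def)
  obtain t where t: "t < ?m" "ps ! t = target I"
    using I(2) by (auto simp: in_set_conv_nth E_def ps_def)
  have dist: "distinct ps" using I(1) by (simp add: pb_instance_def E_def ps_def)
  \<comment> \<open>Here the unary encoding enters: the costs are written out symbol by symbol, so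
    their total is at most the input length.\<close>
  have P: "?m + sum_list (map (cost E) ps) \<le> length ?P"
    by (induction ps) (simp_all add: encode_project_def encode_unary_def E_def)
  have len: "?m \<le> ?N" "sum_list (map (cost E) ps) \<le> ?N"
    using P by (simp_all add: w_eq)
  have "length vs \<le> length (concat (map (encode_voter I) vs))"
    by (induction vs) (simp_all add: encode_voter_def)
  then have vs_len: "length vs \<le> ?N" by (simp add: w_eq)
  \<comment> \<open>\<open>vs\<close> lists every voter once, so counting along it does not depend
    on the chosen enumeration.\<close>
  have disapproval_eq: "length (filter (\<lambda>v. q \<notin> approves E v) vs) = disapproval E q" for q
    using distinct_card[of "filter (\<lambda>v. q \<notin> approves E v) vs"] vs
    by (simp add: disapproval_def)
  have key_le: "disapproval E q \<le> ?N" for q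
    using length_filter_le[of "\<lambda>v. q \<notin> approves E v" vs] vs_len
    by (simp add: disapproval_eq)
  define S1 where "S1 = (store_0 w)\<lparr>r_pos := length ?B, r_budget := budget E\<rparr>"
  define S2 where "S2 = S1\<lparr>r_pos := length ?B + length ?R, r_bound := bound I\<rparr>"
  define S3 where "S3 = S2\<lparr>r_pos := length (?B @ ?R) + length ?P, r_num := ?m, r_target := t,
    r_costs := segment ?m (\<lambda>j. cost E (ps ! j)),
    r_weights := segment ?m (\<lambda>j. weight I (ps ! j))\<rparr>"
  define S4 where "S4 = S3\<lparr>r_pos := length (?B @ ?R @ ?P @ [Sep])\<rparr>"
  define S5 where "S5 = S4\<lparr>r_pos := ?N, r_keys := segment ?m (\<lambda>j. disapproval E (ps ! j))\<rparr>"
  define S6 where "S6 = S5\<lparr>r_table := dp_table E (weight I) (bound I) []\<rparr>"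
  let ?pre = "buckets (disapproval E) ps t (Suc (disapproval E (ps ! t)))"
  define S7 where "S7 = S6\<lparr>r_key := Suc (disapproval E (ps ! t)),
    r_table := dp_table E (weight I) (bound I) ?pre\<rparr>"
  define S8 where "S8 = S7\<lparr>r_entry := 0,
      r_ans := if \<exists>c \<le> r_pos S7. r_table S7 c \<noteq> 0 \<and>
          (c + r_costs S7 (r_target S7) \<le> r_budget S7) \<noteq> destr then 1 else 0\<rparr>"
  note S_defs = S7_def S6_def S5_def S4_def S3_def S2_def S1_def store_0_def
  have 1: "runs (read_number True 3 (Const 0)) (to_store (store_0 w)) (?N * 3 + 2) (to_store S1)"
  proof (rule runs_read_number[where w = w and v = 0 and us = "[]"
        and ys = "binary_digits (budget E)"])
    show "w = [] @ binary_digits (budget E) @ Sep #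
        ?R @ ?P @ [Sep] @ concat (map (encode_voter I) vs)"
      by (simp add: w_eq encode_binary_def)
  qed (auto simp: S1_def store_0_def digits_value_binary_digits Sep_notin_binary_digits
      encode_binary_def intro!: to_store_eqI)
  have 2: "runs (read_number True 4 (Const 0)) (to_store S1) (?N * 3 + 2) (to_store S2)"
  proof (rule runs_read_number[where w = w and v = 0 and us = ?B
        and ys = "binary_digits (bound I)"])
    show "w = ?B @ binary_digits (bound I) @ Sep #
        ?P @ [Sep] @ concat (map (encode_voter I) vs)"
      by (simp add: w_eq encode_binary_def)
  qed (auto simp: S2_def S1_def store_0_def digits_value_binary_digits Sep_notin_binary_digits
      encode_binary_def intro!: to_store_eqI)
  have 3: "runs parse_projects (to_store S2) (?N * (?N * 6 + 9) + 1) (to_store S3)"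
    unfolding S3_def ps_def E_def
    by (rule runs_parse_projects[where vs = "concat (map (encode_voter I) vs)"])
      (use t dist in \<open>simp_all add: S_defs w_eq flip: ps_def E_def\<close>)
  have "straight (increment 2) (to_store S3) = to_store S4"
    by (auto simp: S4_def S3_def intro!: to_store_eqI)
  then have 4: "runs (increment 2) (to_store S3) 1 (to_store S4)"
    by (rule runs_straightI) simp_all
  have "runs parse_voters (to_store S4) (?N * (?N * 4 + 4) + 1) (to_store (S4\<lparr>r_pos := ?N,
      r_keys := segment (length (projects (election I))) (\<lambda>j. length (filter (\<lambda>v.
        projects (election I) ! j \<notin> approves (election I) v) vs))\<rparr>))"
    by (rule runs_parse_voters[where us = "?B @ ?R @ ?P @ [Sep]"])
      (use len in \<open>simp_all add: S_defs w_eq flip: ps_def E_def\<close>)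
  then have 5: "runs parse_voters (to_store S4) (?N * (?N * 4 + 4) + 1) (to_store S5)"
    by (simp add: S5_def disapproval_eq flip: ps_def E_def)
  have "straight (Assign 13 (Const 0) (Plus (Var 4) (Const 1))) (to_store S5) = to_store S6"
    by (auto simp: S_defs dp_table_Nil intro!: to_store_eqI)
  then have 6: "runs (Assign 13 (Const 0) (Plus (Var 4) (Const 1))) (to_store S5) 1 (to_store S6)"
    by (rule runs_straightI) simp_all
  have 7: "runs process_buckets (to_store S6) ((?N + 1) * (?N * ((?N + 1) * 6 + 5) + 7) + 1)
      (to_store S7)"
    unfolding S7_def
    by (rule runs_process_buckets)
      (use t dist len key_le cost_pos in \<open>simp_all add: S_defs\<close>)
  have 8: "runs (search_table destr) (to_store S7) ((?N + 1) * 5 + 2) (to_store S8)"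
    using runs_search_table[of S7 destr] by (simp add: S8_def S_defs)
  have run: "runs (control_program destr) (initial_store w) (control_steps ?N) (to_store S8)"
    unfolding control_program_def control_steps_def initial_store_eq
    by (intro runs_Seq[OF 1] runs_Seq[OF 2] runs_Seq[OF 3] runs_Seq[OF 4] runs_Seq[OF 5]
        runs_Seq[OF 6] runs_Seq[OF 7] 8)
  let ?T = "dp_table E (weight I) (bound I) ?pre"
  obtain ys where "processing_order E = ?pre @ target I # ys"
    using sort_key_prefix_buckets[OF t(1), of "disapproval E"] I(1) t(2)
    by (auto simp: processing_order_disapproval pb_instance_def E_def ps_def)
  then have "(\<exists>D \<in> deletion_sets I.
      (target I \<in> greedyAV (delete_projects D (election I))) \<noteq> destr) \<longleftrightarrow>
      (\<exists>c. ?T c \<noteq> 0 \<and> (c + cost E (target I) \<le> budget E) \<noteq> destr)"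
    using control_iff_dp_table[OF I(1)] by (simp flip: E_def)
  \<comment> \<open>Costs beyond the input length are unattainable, so the bounded search is
    complete.\<close>
  also have "\<dots> \<longleftrightarrow> (\<exists>c \<le> ?N. ?T c \<noteq> 0 \<and> (c + cost E (target I) \<le> budget E) \<noteq> destr)"
  proof -
    have "c \<le> ?N" if "?T c \<noteq> 0" for c
    proof (rule ccontr)
      assume "\<not> c \<le> ?N"
      then have "sum_list (map (cost E) ?pre) < c"
        using sum_list_buckets_le[OF dist, of "cost E" "disapproval E" t
            "Suc (disapproval E (ps ! t))"] len(2)
        by linarith
      from dp_table_eq_0[OF this] that show False by simp
    qed
    then show ?thesis by blast
  qed
  finally have "r_ans S8 = (if \<exists>D \<in> deletion_sets I.
      (target I \<in> greedyAV (delete_projects D (election I))) \<noteq> destr then 1 else 0)"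
    using t by (simp add: S8_def S_defs)
  then show ?thesis using run by (intro exI[of _ "to_store S8"]) simp
qed

lemma poly_control_steps: "poly (control_steps [:0, 1:]) N = control_steps (N :: nat)"
  by (simp add: control_steps_def)

theorem theorem2:
  "polytime_decidable encodings
     (ccdc_inputs (greedyAV :: ('p, 'v) pb \<Rightarrow> 'p set)) (ccdc greedyAV) \<and>
   polytime_decidable encodings
     (dcdc_inputs (greedyAV :: ('p, 'v) pb \<Rightarrow> 'p set)) (dcdc greedyAV)"
proof
  show "polytime_decidable encodings
     (ccdc_inputs (greedyAV :: ('p, 'v) pb \<Rightarrow> 'p set)) (ccdc greedyAV)"
  proof (rule polytime_decidableI)
    fix I :: "('p, 'v) control_input" and w
    assume "I \<in> ccdc_inputs greedyAV" "w \<in> encodings I"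
    then show "\<exists>s. runs (control_program False) (initial_store w)
        (poly (control_steps [:0, 1:]) (length w)) s \<and> s 1 0 = (if ccdc greedyAV I then 1 else 0)"
      using runs_control_program[of I w False]
      unfolding poly_control_steps ccdc_inputs_def ccdc_def by simp
  qed
  show "polytime_decidable encodings
     (dcdc_inputs (greedyAV :: ('p, 'v) pb \<Rightarrow> 'p set)) (dcdc greedyAV)"
  proof (rule polytime_decidableI)
    fix I :: "('p, 'v) control_input" and w
    assume "I \<in> dcdc_inputs greedyAV" "w \<in> encodings I"
    then show "\<exists>s. runs (control_program True) (initial_store w)
        (poly (control_steps [:0, 1:]) (length w)) s \<and> s 1 0 = (if dcdc greedyAV I then 1 else 0)"
      using runs_control_program[of I w True]
      unfolding poly_control_steps dcdc_inputs_def dcdc_def by simp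
  qed
qed

end
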